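(* (i) If $T:C([0,1])\to C([0,1])$ is a sublinear, monotone and strongly translatable operator, then for all $f\in C([0,1])$ we have $$\|f-T(f)\|_{\infty}\le C\{\|f\|_{\infty}\,\lambda_{\infty}+\omega_{2,\infty}(f;\lambda_{\infty}^{1/2})\},$$ where $C$ depends only on the norm $\|T\|$ of $T$. (ii) If $T:L_{1}([0,1])\to L_{1}([0,1])$ is a monotone, sublinear and strongly translatable operator, then for all $f\in L_{1}([0,1])$ we have $$\|f-T(f)\|_{1}\le C\{\|f\|_{1}\,\lambda_{1}+\omega_{3,1}(f;\lambda_{1}^{1/3})\},$$ where $C$ depends only on the norm $\|T\|$ of $T$. Here, for $p=\infty$ in (i) and $p=1$ in (ii), $$\lambda_{p}=\max\{\|T(e_0)-e_0\|_{p},\ \|T(e_1)-e_1\|_{p},\ \|T(-e_1)+e_1\|_{p},\ \|T(e_2)-e_2\|_{p}\}.$$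
   Context: Functions are real-valued; $e_0(x)=1$, $e_1(x)=x$, $e_2(x)=x^2$ on $[0,1]$; $\|\cdot\|_p$ is the norm of $L_p([0,1])$. Let $E$ be $C([0,1])$ or $L_1([0,1])$ with the pointwise (respectively almost everywhere) ordering. An operator $T:E\to E$ (not assumed linear) is called: - sublinear if $T(f+g)\le T(f)+T(g)$ and $T(\alpha f)=\alpha T(f)$ for all $f,g\in E$ and $\alpha\ge 0$; - monotone if $f\le g$ implies $T(f)\le T(g)$ for all $f,g\in E$; - strongly translatable if $T(f+\alpha\cdot 1)=T(f)+\alpha T(1)$ for all $f\in E$ and all $\alpha\in\mathbb{R}$. The norm of $T$ is $\|T\|=\sup\{\|T(f)\|: f\in E,\ \|f\|\le 1\}$ (every sublinear monotone operator on $E$ is Lipschitz continuous with constant $\|T\|<\infty$). The $r$-th order modulus of smoothness in $L_p([0,1])$, $1\le p\le\infty$, is $$\omega_{r,p}(f;\delta)=\sup_{|h|\le\delta}\|\Delta_h^r f\|_p,\qquad \Delta_h^r f(x)=\sum_{j=0}^{r}(-1)^j\binom{r}{j}f(x+(r-j)h),$$ where the $L_p$ norm is taken over those $x\in[0,1]$ with $x+rh\in[0,1]$. *)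

theory Defs
  imports "HOL-Analysis.Analysis" "HOL-Probability.Essential_Supremum"
begin

text \<open>
  Elements of \<open>C([0,1])\<close> and \<open>L\<^sub>1([0,1])\<close> are represented by functions on the reals of which only
  the values on \<open>{0..1}\<close> matter. Equality in the space is the equivalence induced by its ordering:
  equality on \<open>{0..1}\<close> for \<open>C([0,1])\<close>, equality almost everywhere on \<open>{0..1}\<close> for \<open>L\<^sub>1([0,1])\<close>.
  A monotone operator on representatives automatically respects this equivalence, so it is the
  same thing as a monotone operator on the space itself.
\<close>

definition C_01 :: "(real \<Rightarrow> real) set" where
  "C_01 = {f. continuous_on {0..1} f}"

definition L1_01 :: "(real \<Rightarrow> real) set" where
  "L1_01 = {f. integrable (lebesgue_on {0..1}) f}"

definition le_C :: "(real \<Rightarrow> real) \<Rightarrow> (real \<Rightarrow> real) \<Rightarrow> bool" where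
  "le_C f g \<longleftrightarrow> (\<forall>x\<in>{0..1}. f x \<le> g x)"

definition le_L1 :: "(real \<Rightarrow> real) \<Rightarrow> (real \<Rightarrow> real) \<Rightarrow> bool" where
  "le_L1 f g \<longleftrightarrow> (AE x in lebesgue_on {0..1}. f x \<le> g x)"

definition eq_by :: "('a \<Rightarrow> 'a \<Rightarrow> bool) \<Rightarrow> 'a \<Rightarrow> 'a \<Rightarrow> bool" where
  "eq_by le f g \<longleftrightarrow> le f g \<and> le g f"

definition sublinear_on ::
  "(real \<Rightarrow> real) set \<Rightarrow> ((real \<Rightarrow> real) \<Rightarrow> (real \<Rightarrow> real) \<Rightarrow> bool)
    \<Rightarrow> ((real \<Rightarrow> real) \<Rightarrow> (real \<Rightarrow> real)) \<Rightarrow> bool" where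
  "sublinear_on E le T \<longleftrightarrow>
     (\<forall>f\<in>E. \<forall>g\<in>E. le (T (\<lambda>x. f x + g x)) (\<lambda>x. T f x + T g x)) \<and>
     (\<forall>f\<in>E. \<forall>\<alpha>\<ge>0. eq_by le (T (\<lambda>x. \<alpha> * f x)) (\<lambda>x. \<alpha> * T f x))"

definition strongly_translatable_on ::
  "(real \<Rightarrow> real) set \<Rightarrow> ((real \<Rightarrow> real) \<Rightarrow> (real \<Rightarrow> real) \<Rightarrow> bool)
    \<Rightarrow> ((real \<Rightarrow> real) \<Rightarrow> (real \<Rightarrow> real)) \<Rightarrow> bool" where
  "strongly_translatable_on E le T \<longleftrightarrow>
     (\<forall>f\<in>E. \<forall>\<alpha>. eq_by le (T (\<lambda>x. f x + \<alpha>)) (\<lambda>x. T f x + \<alpha> * T (\<lambda>_. 1) x))"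

text \<open>
  The norm of \<open>L\<^sub>p(A)\<close>. On a null set \<open>A\<close> the essential supremum of a measurable function is
  \<open>-\<infinity>\<close>, which \<open>real_of_ereal\<close> sends to 0, so the norm is 0 there for every \<open>p\<close>.
\<close>

definition Lp_norm_on :: "ennreal \<Rightarrow> real set \<Rightarrow> (real \<Rightarrow> real) \<Rightarrow> real" where
  "Lp_norm_on p A f =
     (if p = \<infinity> then real_of_ereal (esssup (lebesgue_on A) (\<lambda>x. ereal \<bar>f x\<bar>))
      else (LINT x|lebesgue_on A. \<bar>f x\<bar> powr enn2real p) powr (1 / enn2real p))"

abbreviation Lp_norm :: "ennreal \<Rightarrow> (real \<Rightarrow> real) \<Rightarrow> real" where
  "Lp_norm p \<equiv> Lp_norm_on p {0..1}"

definition op_norm :: "ennreal \<Rightarrow> (real \<Rightarrow> real) set \<Rightarrow> ((real \<Rightarrow> real) \<Rightarrow> (real \<Rightarrow> real)) \<Rightarrow> real" where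
  "op_norm p E T = (SUP f\<in>{f\<in>E. Lp_norm p f \<le> 1}. Lp_norm p (T f))"

definition finite_diff :: "nat \<Rightarrow> real \<Rightarrow> (real \<Rightarrow> real) \<Rightarrow> real \<Rightarrow> real" where
  "finite_diff r h f x = (\<Sum>j\<le>r. (-1) ^ j * real (r choose j) * f (x + real (r - j) * h))"

definition modulus_of_smoothness :: "nat \<Rightarrow> ennreal \<Rightarrow> (real \<Rightarrow> real) \<Rightarrow> real \<Rightarrow> real" where
  "modulus_of_smoothness r p f \<delta> =
     (SUP h\<in>{h. \<bar>h\<bar> \<le> \<delta>}. Lp_norm_on p {x\<in>{0..1}. x + real r * h \<in> {0..1}} (finite_diff r h f))"

definition korovkin_lambda :: "ennreal \<Rightarrow> ((real \<Rightarrow> real) \<Rightarrow> (real \<Rightarrow> real)) \<Rightarrow> real" where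
  "korovkin_lambda p T = Max
     {Lp_norm p (\<lambda>x. T (\<lambda>_. 1) x - 1),
      Lp_norm p (\<lambda>x. T (\<lambda>t. t) x - x),
      Lp_norm p (\<lambda>x. T (\<lambda>t. - t) x + x),
      Lp_norm p (\<lambda>x. T (\<lambda>t. t\<^sup>2) x - x\<^sup>2)}"

lemma Lp_norm_on_1: "Lp_norm_on 1 A f = (LINT x|lebesgue_on A. \<bar>f x\<bar>)"
  by (simp add: Lp_norm_on_def)

text \<open>On continuous functions the \<open>L\<^sub>\<infinity>\<close> norm is the usual maximum norm.\<close>

lemma Lp_norm_infinity_continuous:
  assumes f: "f \<in> C_01"
  shows "Lp_norm \<infinity> f = (SUP x\<in>{0..1}. \<bar>f x\<bar>)"
proof -
  let ?M = "lebesgue_on {0..1::real}" and ?S = "SUP x\<in>{0..1}. \<bar>f x\<bar>"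
  have cont: "continuous_on {0..1} (\<lambda>x. \<bar>f x\<bar>)"
    using f by (auto simp: C_01_def intro!: continuous_intros)
  have "compact ((\<lambda>x. \<bar>f x\<bar>) ` {0..1})"
    by (rule compact_continuous_image[OF cont]) simp
  then have bdd: "bdd_above ((\<lambda>x. \<bar>f x\<bar>) ` {0..1})"
    by (simp add: bounded_imp_bdd_above compact_imp_bounded)
  have meas_real: "(\<lambda>x. \<bar>f x\<bar>) \<in> borel_measurable ?M"
    by (rule continuous_imp_measurable_on_sets_lebesgue[OF cont]) simp
  then have meas: "(\<lambda>x. ereal \<bar>f x\<bar>) \<in> borel_measurable ?M"
    by simp
  have "AE x in ?M. ereal \<bar>f x\<bar> \<le> ereal ?S"
    using bdd by (intro AE_I2) (auto simp: space_restrict_space intro!: cSUP_upper)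
  then have upper: "esssup ?M (\<lambda>x. ereal \<bar>f x\<bar>) \<le> ereal ?S"
    by (rule esssup_I[OF meas])
  have nontriv: "emeasure ?M (space ?M) \<noteq> 0"
    by (simp add: space_restrict_space emeasure_restrict_space)
  have "esssup ?M (\<lambda>_. 0::ereal) \<le> esssup ?M (\<lambda>x. ereal \<bar>f x\<bar>)"
    by (rule esssup_mono) auto
  then have nonneg: "0 \<le> esssup ?M (\<lambda>x. ereal \<bar>f x\<bar>)"
    using esssup_const[OF nontriv, of "0::ereal"] by simp
  obtain c where c: "esssup ?M (\<lambda>x. ereal \<bar>f x\<bar>) = ereal c"
    using upper nonneg by (cases "esssup ?M (\<lambda>x. ereal \<bar>f x\<bar>)") auto
  have "AE x in ?M. \<bar>f x\<bar> \<le> c"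
    using esssup_AE[of "\<lambda>x. ereal \<bar>f x\<bar>" ?M] c by simp
  then have "AE x in lebesgue. x \<in> {0..1} \<longrightarrow> \<bar>f x\<bar> \<le> c"
    by (subst (asm) AE_restrict_space_iff) auto
  then have ae: "AE x \<in> {0<..<1} in lebesgue. x \<in> {x\<in>{0..1}. \<bar>f x\<bar> \<le> c}"
    by (auto elim!: eventually_mono)
  have cl: "closed {x\<in>{0..1}. \<bar>f x\<bar> \<le> c}"
    using continuous_closed_preimage[OF cont, of "{..c}"]
    by (auto simp: vimage_def Int_def intro: back_subst[of closed])
  have "{0<..<1} \<subseteq> {x\<in>{0..1}. \<bar>f x\<bar> \<le> c}"
    using mem_closed_if_AE_lebesgue_open[OF open_greaterThanLessThan cl ae] by blast
  then have "closure {0<..<1} \<subseteq> {x\<in>{0..1}. \<bar>f x\<bar> \<le> c}"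
    by (rule closure_minimal[OF _ cl])
  then have "?S \<le> c"
    by (intro cSUP_least) (auto simp: closure_greaterThanLessThan)
  then show ?thesis
    using upper c by (simp add: Lp_norm_on_def)
qed

end

theory Submission
  imports Defs
begin

text \<open>
  For a \<open>C\<^sup>2\<close> function \<open>g\<close>, Taylor's formula encloses \<open>g\<close> between two quadratic polynomials
  that touch it at a given node \<open>x\<close>. A sublinear monotone operator preserves the enclosure, and its
  value on a quadratic polynomial is controlled by the test functions (\<open>- e\<^sub>1\<close> is needed since the
  linear coefficient may be negative). In \<open>L\<^sub>1\<close> the node and the evaluation point must be decoupled,
  because inequalities hold almost everywhere only: the nodes range over a countable dense set and
  then tend to the evaluation point.

  A general \<open>f\<close> is replaced by averages of \<open>f(x + k\<epsilon>(u - x))\<close> over \<open>u\<close>, combined such that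
  \<open>g - f\<close> is an average of \<open>r\<close>-th differences of \<open>f\<close> with steps at most \<open>\<epsilon>\<close>. In \<open>L\<^sub>1\<close> the estimate
  needs the maximum of \<open>\<bar>g''\<bar>\<close>, which is bounded by the \<open>L\<^sub>1\<close> norms of \<open>g\<close> and of its third
  derivative; this is why third differences occur there. Finally \<open>\<epsilon>\<^sup>r = \<lambda>\<close>.
\<close>

subsection \<open>Smoothing by B-spline averages\<close>

text \<open>The B-spline weights never appear as functions: a difference of an iterated
  antiderivative is the weighted average, and the mean value theorem reduces \<open>g - f\<close> to
  one value or, in the mean, to one increment. The antiderivatives are classical and live on the
  whole line, so a continuous function is extended by constants and an integrable one is replaced by
  a continuous approximation, whose error \<eta> is removed at the end. The choice \<epsilon>^r =
  \<lambda> balances the term \<omega> / \<epsilon>^r in the derivative bounds against the factor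
  \<lambda> from the test functions. It is available only for small positive \<lambda>, because the
  outermost node must remain a convex combination of \<open>x\<close> and \<open>u\<close>. For
  large \<lambda> the trivial bound by 1 + L times the norm of \<open>f\<close> suffices. For
  \<lambda> = 0 the right side vanishes, so \<open>f\<close> and \<open>T f\<close> must be shown
  equal, with \<epsilon> chosen independently of \<lambda>. Another obstacle is that
  \<open>T\<close> need not be odd and that -e_2 is no test function: only upper bounds of
  \<open>T\<close> on quadratics with nonnegative leading coefficient are at hand, and lower bounds
  come from \<open>- g\<close>.\<close>

lemma second_difference_mvt:
  fixes K K1 k :: "real \<Rightarrow> real"
  assumes K: "\<And>x. (K has_real_derivative K1 x) (at x)"
    and K1: "\<And>x. (K1 has_real_derivative k x) (at x)" and h: "h > 0"
  obtains \<xi> where "a < \<xi>" "\<xi> < a + 2 * h" "K (a + 2 * h) - 2 * K (a + h) + K a = h\<^sup>2 * k \<xi>"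
proof -
  have chain: "((\<lambda>t. K (t + h)) has_real_derivative K1 (t + h)) (at t)" for t
    using K[of "t + h"] by (simp add: DERIV_shift)
  have "\<exists>s. a < s \<and> s < a + h \<and>
      (K (a + h + h) - K (a + h)) - (K (a + h) - K a) = (a + h - a) * (K1 (s + h) - K1 s)"
    using h by (intro MVT2[of a "a + h" "\<lambda>t. K (t + h) - K t"] DERIV_diff chain K) auto
  then obtain s where s: "a < s" "s < a + h"
      "(K (a + h + h) - K (a + h)) - (K (a + h) - K a) = h * (K1 (s + h) - K1 s)"
    by auto
  have "\<exists>\<xi>. s < \<xi> \<and> \<xi> < s + h \<and> K1 (s + h) - K1 s = (s + h - s) * k \<xi>"
    using h by (intro MVT2 K1) auto
  then obtain \<xi> where "s < \<xi>" "\<xi> < s + h" "K1 (s + h) - K1 s = h * k \<xi>" by auto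
  then show thesis
    using s by (intro that[of \<xi>]) (auto simp: power2_eq_square algebra_simps)
qed

text \<open>Only two of the three differences are resolved by mean values. The remaining increment
  of \<open>k\<close> can be bounded by the integral of its derivative; resolving it too would leave
  a single value of a function that is controlled only in the mean.\<close>

lemma third_difference_mvt:
  fixes K K1 k :: "real \<Rightarrow> real"
  assumes K: "\<And>x. (K has_real_derivative K1 x) (at x)"
    and K1: "\<And>x. (K1 has_real_derivative k x) (at x)" and h: "h > 0"
  obtains \<xi> where "a < \<xi>" "\<xi> < a + 2 * h"
    "K (a + 3 * h) - 3 * K (a + 2 * h) + 3 * K (a + h) - K a = h\<^sup>2 * (k (\<xi> + h) - k \<xi>)"
proof -
  have "((\<lambda>t. K (t + h) - K t) has_real_derivative K1 (t + h) - K1 t) (at t)" for t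
    using K[of "t + h"] K[of t] by (auto simp: DERIV_shift intro: DERIV_diff)
  moreover have "((\<lambda>t. K1 (t + h) - K1 t) has_real_derivative k (t + h) - k t) (at t)" for t
    using K1[of "t + h"] K1[of t] by (auto simp: DERIV_shift intro: DERIV_diff)
  ultimately obtain \<xi> where \<xi>: "a < \<xi>" "\<xi> < a + 2 * h"
    "(K (a + 2 * h + h) - K (a + 2 * h)) - 2 * (K (a + h + h) - K (a + h)) + (K (a + h) - K a)
      = h\<^sup>2 * (k (\<xi> + h) - k \<xi>)"
    by (rule second_difference_mvt[where h = h and a = a]) (use h in auto)
  moreover have "a + 2 * h + h = a + 3 * h" "a + h + h = a + 2 * h" by auto
  ultimately show thesis
    by (intro that[of \<xi>]) auto
qed

text \<open>The two-sided form serves twice: it gives a majorant of \<open>g\<close> to which the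
  operator is applied, and it compares that majorant with \<open>g\<close> at the evaluation
  point.\<close>

lemma taylor_quadratic_bound:
  fixes g g' g'' :: "real \<Rightarrow> real"
  assumes g: "\<And>x. (g has_real_derivative g' x) (at x)"
    and g': "\<And>x. (g' has_real_derivative g'' x) (at x)"
    and K: "\<And>x. x \<in> {0..1} \<Longrightarrow> \<bar>g'' x\<bar> \<le> K"
    and x: "x \<in> {0..1}" and t: "t \<in> {0..1}"
  shows "\<bar>g t - (g x + g' x * (t - x))\<bar> \<le> K / 2 * (t - x)\<^sup>2"
proof (cases "t = x")
  case False
  define d where "d m = (if m = 0 then g else if m = 1 then g' else g'')" for m :: nat
  have "DERIV (d m) y :> d (Suc m) y" if "m < 2" for m y
    using that g[of y] g'[of y] by (cases "m = 0") (auto simp: d_def less_2_cases_iff)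
  then have "\<exists>\<xi>. (if t < x then t < \<xi> \<and> \<xi> < x else x < \<xi> \<and> \<xi> < t) \<and>
      g t = (\<Sum>m<2. d m x / fact m * (t - x) ^ m) + d 2 \<xi> / fact 2 * (t - x) ^ 2"
    using x t False by (intro Taylor[where a = 0 and b = 1]) (simp_all add: d_def)
  then obtain \<xi> where \<xi>: "if t < x then t < \<xi> \<and> \<xi> < x else x < \<xi> \<and> \<xi> < t"
      and eq': "g t = (\<Sum>m<2. d m x / fact m * (t - x) ^ m) + d 2 \<xi> / fact 2 * (t - x) ^ 2"
    by blast
  have eq: "g t - (g x + g' x * (t - x)) = g'' \<xi> / 2 * (t - x)\<^sup>2"
    unfolding eq' by (simp add: d_def numeral_2_eq_2)
  have "\<xi> \<in> {0..1}" using \<xi> x t by (auto split: if_splits)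
  from K[OF this] show ?thesis
    unfolding eq by (auto simp: abs_mult intro!: mult_right_mono)
qed auto

lemma antiderivative_exists:
  fixes f :: "real \<Rightarrow> real"
  assumes "continuous_on UNIV f"
  obtains F where "\<And>x. (F has_real_derivative f x) (at x)"
proof -
  have "\<exists>F. \<forall>x. -\<infinity> < ereal x \<longrightarrow> ereal x < \<infinity> \<longrightarrow> (F has_vector_derivative f x) (at x)"
    using assms by (intro einterval_antiderivative) (auto simp: continuous_on_eq_continuous_at)
  then show thesis
    using that by (auto simp: has_real_derivative_iff_has_vector_derivative)
qed

lemma continuous_on_if_deriv:
  assumes "\<And>x. (F has_real_derivative f x) (at x)"
  shows "continuous_on A F"
  by (meson DERIV_isCont assms continuous_at_imp_continuous_on)

lemma convex_step_in_unit:
  fixes x u e :: real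
  assumes "x \<in> {0..1}" "u \<in> {0..1}" "0 \<le> e" "e \<le> 1"
  shows "x + e * (u - x) \<in> {0..1}"
proof -
  have "(1 - e) * x + e * u \<in> {0..1}"
    using assms convexD_alt[of "{0..1::real}" x u e] by simp
  then show ?thesis by (simp add: algebra_simps)
qed

text \<open>
  The nodes \<open>x + k\<epsilon>(u - x)\<close> with \<open>u \<in> {0..1}\<close> stay in the unit interval, so the averages
  over \<open>u\<close> need no extension of \<open>f\<close> and no modification near the end points. They are affine in
  \<open>x\<close> for fixed \<open>u\<close>; choosing a B-spline weight makes their derivatives differences of \<open>f\<close>.
\<close>

lemma smoothing_second_order:
  fixes f :: "real \<Rightarrow> real"
  assumes f: "continuous_on UNIV f" and e: "0 < \<epsilon>" "\<epsilon> \<le> 1 / 2"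
    and W: "\<And>h x. \<bar>h\<bar> \<le> \<epsilon> \<Longrightarrow> x \<in> {0..1} \<Longrightarrow> x + 2 * h \<in> {0..1} \<Longrightarrow>
              \<bar>f (x + 2 * h) - 2 * f (x + h) + f x\<bar> \<le> W"
  obtains g g' g'' where "\<And>x. (g has_real_derivative g' x) (at x)"
    "\<And>x. (g' has_real_derivative g'' x) (at x)"
    "\<And>x. x \<in> {0..1} \<Longrightarrow> \<bar>g x - f x\<bar> \<le> W"
    "\<And>x. x \<in> {0..1} \<Longrightarrow> \<bar>g'' x\<bar> \<le> 9 * W / \<epsilon>\<^sup>2"
proof -
  obtain F1 where F1: "\<And>x. (F1 has_real_derivative f x) (at x)"
    using antiderivative_exists[OF f] by blast
  obtain F2 where F2: "\<And>x. (F2 has_real_derivative F1 x) (at x)"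
    using antiderivative_exists[OF continuous_on_if_deriv[OF F1]] by blast
  note chain1 = DERIV_chain2[OF F1] and chain2 = DERIV_chain2[OF F2]
  \<comment> \<open>The three points are the images of 0, 1/2 and 1 under
    \<open>u \<mapsto> x + e * (u - x)\<close>. With \<open>G = F2\<close> and \<open>c\<close> the
    inverse square of the step \<open>e / 2\<close>, this is the average of
    \<open>f (x + e * (u - x))\<close> against the hat function on the unit interval. The exponent
    \<open>n\<close> counts derivatives in \<open>x\<close>, each of which costs a factor
    \<open>1 - e\<close>.\<close>
  define P where "P c G e n x = c * (1 - e) ^ n *
      (G ((1 - e) * x + e) - 2 * G ((1 - e) * x + e / 2) + G ((1 - e) * x))"
    for c :: real and G :: "real \<Rightarrow> real" and e x and n :: nat
  have P0: "(P c F2 e 0 has_real_derivative P c F1 e 1 x) (at x)" for c e x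
    unfolding P_def
    by (rule derivative_eq_intros chain2 refl)+ (simp add: algebra_simps)
  have P1: "(P c F1 e 1 has_real_derivative P c f e 2 x) (at x)" for c e x
    unfolding P_def
    by (rule derivative_eq_intros chain1 refl)+ (simp add: algebra_simps power2_eq_square)
  \<comment> \<open>The weights 2 and -1 at the scales \<epsilon> and 2 \<epsilon> make
    \<open>f - g\<close> the average of second differences with step
    \<open>\<epsilon> * (u - x)\<close>. The factors \<open>c\<close> are 4 / e^2 for these two
    scales.\<close>
  define g g' g'' where "g x = 2 * P (4 / \<epsilon>\<^sup>2) F2 \<epsilon> 0 x - P (1 / \<epsilon>\<^sup>2) F2 (2 * \<epsilon>) 0 x"
    and "g' x = 2 * P (4 / \<epsilon>\<^sup>2) F1 \<epsilon> 1 x - P (1 / \<epsilon>\<^sup>2) F1 (2 * \<epsilon>) 1 x"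
    and "g'' x = 2 * P (4 / \<epsilon>\<^sup>2) f \<epsilon> 2 x - P (1 / \<epsilon>\<^sup>2) f (2 * \<epsilon>) 2 x" for x
  have "(g has_real_derivative g' x) (at x)" for x
    unfolding g_def g'_def by (rule derivative_eq_intros P0 refl)+ simp
  moreover have "(g' has_real_derivative g'' x) (at x)" for x
    unfolding g'_def g''_def by (rule derivative_eq_intros P1 refl)+ simp
  moreover have "\<bar>g x - f x\<bar> \<le> W" if x: "x \<in> {0..1}" for x
  proof -
    define y where "y k u = x + k * \<epsilon> * (u - x)" for k u :: real
    \<comment> \<open>\<open>K\<close> is a second antiderivative, in the variable \<open>u\<close>,
      of the difference \<open>k\<close> to be averaged. Its second difference with step 1/2 is a
      quarter of \<open>g x - f x\<close>; the quadratic term accounts for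
      \<open>f x\<close>.\<close>
    define K where "K u = 2 * F2 (y 1 u) / \<epsilon>\<^sup>2 - F2 (y 2 u) / (4 * \<epsilon>\<^sup>2) - f x * u\<^sup>2 / 2" for u
    define K1 where "K1 u = 2 * F1 (y 1 u) / \<epsilon> - F1 (y 2 u) / (2 * \<epsilon>) - f x * u" for u
    define k where "k u = 2 * f (y 1 u) - f (y 2 u) - f x" for u
    have "(K has_real_derivative K1 u) (at u)" for u
      unfolding K_def K1_def y_def using e
      by (auto intro!: derivative_eq_intros chain2 simp: field_simps power2_eq_square)
    moreover have "(K1 has_real_derivative k u) (at u)" for u
      unfolding K1_def k_def y_def using e
      by (auto intro!: derivative_eq_intros chain1 simp: field_simps)
    ultimately obtain u where u: "0 < u" "u < 1" and
      Keq: "K 1 - 2 * K (1 / 2) + K 0 = k u / 4"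
      by (rule second_difference_mvt[of K K1 k "1 / 2" 0]) (auto simp: power2_eq_square)
    have y: "y 1 0 = (1 - \<epsilon>) * x" "y 1 (1 / 2) = (1 - \<epsilon>) * x + \<epsilon> / 2" "y 1 1 = (1 - \<epsilon>) * x + \<epsilon>"
      "y 2 0 = (1 - 2 * \<epsilon>) * x" "y 2 (1 / 2) = (1 - 2 * \<epsilon>) * x + \<epsilon>"
      "y 2 1 = (1 - 2 * \<epsilon>) * x + 2 * \<epsilon>"
      by (auto simp: y_def algebra_simps)
    have "g x - f x = 4 * (K 1 - 2 * K (1 / 2) + K 0)"
      unfolding g_def P_def K_def y using e by (simp add: field_simps power2_eq_square)
    then have eq: "g x - f x = k u"
      using Keq by simp
    have "x + 2 * (\<epsilon> * (u - x)) \<in> {0..1}"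
      using convex_step_in_unit[of x u "2 * \<epsilon>"] e x u by (simp add: mult.assoc)
    moreover have "\<bar>\<epsilon> * (u - x)\<bar> \<le> \<epsilon> * 1"
      unfolding abs_mult using e x u by (intro mult_mono) auto
    ultimately have "\<bar>f (x + 2 * (\<epsilon> * (u - x))) - 2 * f (x + \<epsilon> * (u - x)) + f x\<bar> \<le> W"
      using W x by simp
    moreover have "k u = - (f (x + 2 * (\<epsilon> * (u - x))) - 2 * f (x + \<epsilon> * (u - x)) + f x)"
      by (simp add: k_def y_def mult.assoc)
    ultimately show ?thesis
      unfolding eq by linarith
  qed
  moreover have "\<bar>g'' x\<bar> \<le> 9 * W / \<epsilon>\<^sup>2" if x: "x \<in> {0..1}" for x
  proof -
    \<comment> \<open>After two derivatives the average has become a second difference of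
      \<open>f\<close> with step \<open>e / 2\<close>, at most \<epsilon>. Hence the constant 9 = 2
      * 4 + 1.\<close>
    have P_le: "\<bar>P c f e 2 x\<bar> \<le> c * W" if e': "0 < e" "e \<le> 2 * \<epsilon>" "c \<ge> 0" for c e
    proof -
      have "(1 - e) * x \<le> (1 - e) * 1" "0 \<le> (1 - e) * x"
        using e e' x by (intro mult_left_mono mult_nonneg_nonneg; simp)+
      then have "(1 - e) * x \<in> {0..1}" "(1 - e) * x + 2 * (e / 2) \<in> {0..1}"
        using e e' x by auto
      then have "\<bar>f ((1 - e) * x + 2 * (e / 2)) - 2 * f ((1 - e) * x + e / 2) + f ((1 - e) * x)\<bar> \<le> W"
        using e' by (intro W) auto
      then have "(1 - e)\<^sup>2 *
          \<bar>f ((1 - e) * x + e) - 2 * f ((1 - e) * x + e / 2) + f ((1 - e) * x)\<bar> \<le> 1 * W"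
        using e e' by (intro mult_mono) (auto simp: power_le_one)
      then have "c * ((1 - e)\<^sup>2 *
          \<bar>f ((1 - e) * x + e) - 2 * f ((1 - e) * x + e / 2) + f ((1 - e) * x)\<bar>) \<le> c * (1 * W)"
        using e' by (intro mult_left_mono) auto
      then show ?thesis
        using e' by (simp add: P_def abs_mult)
    qed
    have "\<bar>g'' x\<bar> \<le> 2 * \<bar>P (4 / \<epsilon>\<^sup>2) f \<epsilon> 2 x\<bar> + \<bar>P (1 / \<epsilon>\<^sup>2) f (2 * \<epsilon>) 2 x\<bar>"
      unfolding g''_def by linarith
    also have "\<dots> \<le> 2 * (4 / \<epsilon>\<^sup>2 * W) + 1 / \<epsilon>\<^sup>2 * W"
      using e by (intro add_mono mult_left_mono P_le) auto
    also have "\<dots> = 9 * W / \<epsilon>\<^sup>2"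
      using e by (simp add: field_simps power2_eq_square)
    finally show ?thesis .
  qed
  ultimately show thesis
    by (rule that)
qed

section \<open>Third-order smoothing in the mean\<close>

lemma abs_increment_le_integral:
  fixes F f :: "real \<Rightarrow> real"
  assumes F: "\<And>x. (F has_real_derivative f x) (at x)" and f: "continuous_on UNIV f"
    and ab: "a \<in> {c..d}" "b \<in> {c..d}"
  shows "\<bar>F b - F a\<bar> \<le> integral {c..d} (\<lambda>x. \<bar>f x\<bar>)"
proof -
  have cont: "continuous_on A (\<lambda>x. \<bar>f x\<bar>)" for A
    by (intro continuous_intros continuous_on_subset[OF f]) auto
  have "\<bar>F b - F a\<bar> \<le> integral {c..d} (\<lambda>x. \<bar>f x\<bar>)" if "a \<in> {c..d}" "b \<in> {c..d}" "a \<le> b" for a b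
  proof -
    have "(f has_integral (F b - F a)) {a..b}"
      using that F by (intro fundamental_theorem_of_calculus)
        (auto simp flip: has_real_derivative_iff_has_vector_derivative intro: has_field_derivative_at_within)
    then have "F b - F a = integral {a..b} f" "f integrable_on {a..b}"
      by (auto simp: integral_unique)
    then have "\<bar>F b - F a\<bar> \<le> integral {a..b} (\<lambda>x. \<bar>f x\<bar>)"
      using integral_norm_bound_integral[of f "{a..b}" "\<lambda>x. \<bar>f x\<bar>"]
      by (auto intro!: integrable_continuous_real cont)
    also have "\<dots> \<le> integral {c..d} (\<lambda>x. \<bar>f x\<bar>)"
      using that by (intro integral_subset_le integrable_continuous_real cont) auto
    finally show ?thesis .
  qed
  from this[of a b] this[of b a] ab show ?thesis
    by (cases "a \<le> b") (auto simp: abs_minus_commute)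
qed

text \<open>For fixed \<open>x\<close> the substitution \<open>h = \<epsilon> * (u - x)\<close> has
  Jacobian \<open>1 / \<epsilon>\<close> and leads to steps in
  \<open>{-\<epsilon>..\<epsilon>}\<close> for which \<open>x + 3 * h\<close> stays in the unit
  interval. After the integrals are exchanged each step contributes at most \<open>W\<close>, and
  the steps fill an interval of length \<open>2 * \<epsilon>\<close>. With nonnegative extended
  integrals the domain can be enlarged and the order exchanged given measurability alone.\<close>

lemma integral_average_difference_le:
  fixes D :: "real \<Rightarrow> real \<Rightarrow> real"
  assumes cont: "continuous_on UNIV (\<lambda>(h, x). D h x)" and e: "0 < \<epsilon>" "\<epsilon> \<le> 1 / 3"
    and nonneg: "\<And>h x. 0 \<le> D h x"
    and W: "\<And>h. \<bar>h\<bar> \<le> \<epsilon> \<Longrightarrow> integral {x \<in> {0..1}. x + 3 * h \<in> {0..1}} (D h) \<le> W"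
  shows "integral {0..1} (\<lambda>x. integral {0..1} (\<lambda>u. D (\<epsilon> * (u - x)) x)) \<le> 2 * W"
proof -
  have cont_comp: "continuous_on A (\<lambda>t. D (p t) (q t))"
    if "continuous_on A p" "continuous_on A q" for A :: "'a::topological_space set" and p q
    using continuous_on_compose2[OF cont continuous_on_Pair[OF that]] by auto
  have [measurable]: "(\<lambda>z. D (p z) (q z)) \<in> borel_measurable M"
    if [measurable]: "p \<in> borel_measurable M" "q \<in> borel_measurable M" for M :: "'b measure" and p q
    using measurable_compose[OF _ borel_measurable_continuous_onI[OF cont], of "\<lambda>z. (p z, q z)" M]
    by (simp add: borel_prod)
  define A where "A h = {x \<in> {0..1}. x + 3 * h \<in> {0..1}}" for h :: real
  have A_interval: "A h = {max 0 (- 3 * h)..min 1 (1 - 3 * h)}" for h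
    by (auto simp: A_def)
  have [measurable]: "Measurable.pred (borel \<Otimes>\<^sub>M borel) (\<lambda>(h, x). x \<in> A h)"
    unfolding A_def by measurable
  define G where "G x = integral {0..1} (\<lambda>u. D (\<epsilon> * (u - x)) x)" for x
  have D_cont: "continuous_on B (D h)" "continuous_on B (\<lambda>u. D (\<epsilon> * (u - x)) x)" for B h x
    by (rule cont_comp[of _ "\<lambda>_. h" "\<lambda>x. x"]; intro continuous_intros)
       (rule cont_comp; intro continuous_intros)
  have W0: "0 \<le> W"
  proof -
    have "0 \<le> integral {0..1} (D 0)"
      by (intro integral_nonneg integrable_continuous_real D_cont nonneg)
    also have "{0..1} = {x \<in> {0..1}. x + 3 * 0 \<in> {0..1::real}}" by auto
    also have "integral \<dots> (D 0) \<le> W" using e by (intro W) auto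
    finally show ?thesis .
  qed
  have G_cont: "continuous_on {0..1} G"
  proof -
    have "continuous_on (cbox 0 1) (\<lambda>x. integral (cbox 0 1) ((\<lambda>x u. D (\<epsilon> * (u - x)) x) x))"
      by (rule integral_continuous_on_param)
         (unfold case_prod_beta, intro cont_comp continuous_intros)
    then show ?thesis by (simp add: G_def cbox_interval)
  qed
  have G_nonneg: "0 \<le> G x" for x
    unfolding G_def
    by (intro integral_nonneg integrable_continuous_real D_cont nonneg)
  have G_eq: "ennreal (G x) = (\<integral>\<^sup>+u. ennreal (D (\<epsilon> * (u - x)) x) * indicator {0..1} u \<partial>lborel)" for x
    unfolding G_def
    by (rule nn_integral_has_integral_lebesgue'[symmetric])
       (intro nonneg integrable_integral integrable_continuous_real D_cont)+
  have G_le: "ennreal (G x) * indicator {0..1} x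
      \<le> ennreal (1 / \<epsilon>) * (\<integral>\<^sup>+h. ennreal (D h x) * indicator (A h) x * indicator {-\<epsilon>..\<epsilon>} h \<partial>lborel)" for x
  proof (cases "x \<in> {0..1}")
    case True
    have "ennreal (G x) = ennreal \<bar>1 / \<epsilon>\<bar> *
        (\<integral>\<^sup>+h. ennreal (D (\<epsilon> * (x + 1 / \<epsilon> * h - x)) x) * indicator {0..1} (x + 1 / \<epsilon> * h) \<partial>lborel)"
      unfolding G_eq using e by (intro nn_integral_real_affine) auto
    also have "\<dots> \<le> ennreal (1 / \<epsilon>) *
        (\<integral>\<^sup>+h. ennreal (D h x) * indicator (A h) x * indicator {-\<epsilon>..\<epsilon>} h \<partial>lborel)"
    proof (rule mult_mono[OF _ nn_integral_mono])
      fix h :: real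
      show "ennreal (D (\<epsilon> * (x + 1 / \<epsilon> * h - x)) x) * indicator {0..1} (x + 1 / \<epsilon> * h)
          \<le> ennreal (D h x) * indicator (A h) x * indicator {-\<epsilon>..\<epsilon>} h"
      proof (cases "x + 1 / \<epsilon> * h \<in> {0..1}")
        case u: True
        define u where "u = x + 1 / \<epsilon> * h"
        have h: "h = \<epsilon> * (u - x)" using e by (simp add: u_def)
        have "\<bar>u - x\<bar> \<le> 1" using u True by (auto simp: u_def)
        then have "\<bar>h\<bar> \<le> \<epsilon> * 1"
          unfolding h abs_mult using e by (intro mult_mono) auto
        moreover have "x + 3 * h \<in> {0..1}"
          using convex_step_in_unit[of x u "3 * \<epsilon>"] True u e by (simp add: u_def[symmetric] h mult.assoc)
        ultimately show ?thesis
          using True e by (auto simp: A_def indicator_def)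
      qed auto
    qed (use e in auto)
    finally show ?thesis using True by simp
  qed auto
  have "ennreal (integral {0..1} G) = (\<integral>\<^sup>+x. ennreal (G x) * indicator {0..1} x \<partial>lborel)"
    by (rule nn_integral_has_integral_lebesgue'[symmetric])
       (intro G_nonneg integrable_integral integrable_continuous_real G_cont)+
  also have "\<dots> \<le> (\<integral>\<^sup>+x. ennreal (1 / \<epsilon>) *
      (\<integral>\<^sup>+h. ennreal (D h x) * indicator (A h) x * indicator {-\<epsilon>..\<epsilon>} h \<partial>lborel) \<partial>lborel)"
    by (intro nn_integral_mono G_le)
  also have "\<dots> = ennreal (1 / \<epsilon>) *
      (\<integral>\<^sup>+x. (\<integral>\<^sup>+h. ennreal (D h x) * indicator (A h) x * indicator {-\<epsilon>..\<epsilon>} h \<partial>lborel) \<partial>lborel)"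
    by (intro nn_integral_cmult) measurable
  also have "(\<integral>\<^sup>+x. (\<integral>\<^sup>+h. ennreal (D h x) * indicator (A h) x * indicator {-\<epsilon>..\<epsilon>} h \<partial>lborel) \<partial>lborel)
      = (\<integral>\<^sup>+h. (\<integral>\<^sup>+x. ennreal (D h x) * indicator (A h) x * indicator {-\<epsilon>..\<epsilon>} h \<partial>lborel) \<partial>lborel)"
    by (intro lborel_pair.Fubini') measurable
  also have "\<dots> \<le> (\<integral>\<^sup>+h. ennreal W * indicator {-\<epsilon>..\<epsilon>} h \<partial>lborel)"
  proof (intro nn_integral_mono)
    fix h :: real
    show "(\<integral>\<^sup>+x. ennreal (D h x) * indicator (A h) x * indicator {-\<epsilon>..\<epsilon>} h \<partial>lborel)
        \<le> ennreal W * indicator {-\<epsilon>..\<epsilon>} h"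
    proof (cases "h \<in> {-\<epsilon>..\<epsilon>}")
      case True
      have "(\<integral>\<^sup>+x. ennreal (D h x) * indicator (A h) x \<partial>lborel) = ennreal (integral (A h) (D h))"
        unfolding A_interval
        by (rule nn_integral_has_integral_lebesgue')
           (intro nonneg integrable_integral integrable_continuous_real D_cont)+
      also have "\<dots> \<le> ennreal W"
        using W[of h] True by (intro ennreal_leI) (auto simp: A_def)
      finally show ?thesis using True by simp
    qed auto
  qed
  also have "\<dots> = ennreal (W * (2 * \<epsilon>))"
    using e W0 by (subst nn_integral_cmult) (auto simp: ennreal_mult)
  finally have "ennreal (integral {0..1} G) \<le> ennreal (1 / \<epsilon>) * ennreal (W * (2 * \<epsilon>))"
    by (simp add: mult_left_mono)
  also have "\<dots> = ennreal (2 * W)"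
    using e W0 by (simp flip: ennreal_mult)
  finally show ?thesis
    using W0 by (simp add: G_def[abs_def])
qed

text \<open>The same scheme with the quadratic B-spline, the weights 3, -3, 1 and the scales
  \<epsilon>, 2 \<epsilon>, 3 \<epsilon>, so that \<open>g - f\<close> averages third differences.
  As these are controlled only in the mean, the oscillation of \<open>g''\<close> takes the place of
  a pointwise bound on a third derivative.\<close>

lemma smoothing_third_order:
  fixes f :: "real \<Rightarrow> real"
  assumes f: "continuous_on UNIV f" and e: "0 < \<epsilon>" "\<epsilon> \<le> 1 / 3"
    and W: "\<And>h. \<bar>h\<bar> \<le> \<epsilon> \<Longrightarrow> integral {x \<in> {0..1}. x + 3 * h \<in> {0..1}}
              (\<lambda>x. \<bar>f (x + 3 * h) - 3 * f (x + 2 * h) + 3 * f (x + h) - f x\<bar>) \<le> W"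
  obtains g g' g'' where "\<And>x. (g has_real_derivative g' x) (at x)"
    "\<And>x. (g' has_real_derivative g'' x) (at x)"
    "integral {0..1} (\<lambda>x. \<bar>g x - f x\<bar>) \<le> 6 * W"
    "\<And>x y. x \<in> {0..1} \<Longrightarrow> y \<in> {0..1} \<Longrightarrow> \<bar>g'' x - g'' y\<bar> \<le> 93 * W / \<epsilon> ^ 3"
proof -
  have f_cont: "continuous_on A (\<lambda>t. f (p t))"
    if "continuous_on A p" for A :: "'a::topological_space set" and p
    using continuous_on_compose2[OF f that] by auto
  obtain F1 where F1: "\<And>x. (F1 has_real_derivative f x) (at x)"
    using antiderivative_exists[OF f] by blast
  obtain F2 where F2: "\<And>x. (F2 has_real_derivative F1 x) (at x)"
    using antiderivative_exists[OF continuous_on_if_deriv[OF F1]] by blast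
  obtain F3 where F3: "\<And>x. (F3 has_real_derivative F2 x) (at x)"
    using antiderivative_exists[OF continuous_on_if_deriv[OF F2]] by blast
  note chain = DERIV_chain2[OF F1] DERIV_chain2[OF F2] DERIV_chain2[OF F3]
  define D where "D h x = f (x + 3 * h) - 3 * f (x + 2 * h) + 3 * f (x + h) - f x" for h x
  define P where "P c G e n x = c * (1 - e) ^ n *
      (G ((1 - e) * x + e) - 3 * G ((1 - e) * x + 2 * e / 3) + 3 * G ((1 - e) * x + e / 3)
        - G ((1 - e) * x))"
    for c :: real and G :: "real \<Rightarrow> real" and e x and n :: nat
  have P0: "(P c F3 e 0 has_real_derivative P c F2 e 1 x) (at x)" for c e x
    unfolding P_def
    by (rule derivative_eq_intros chain(3) refl)+ (simp add: algebra_simps)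
  have P1: "(P c F2 e 1 has_real_derivative P c F1 e 2 x) (at x)" for c e x
    unfolding P_def
    by (rule derivative_eq_intros chain(2) refl)+ (simp add: algebra_simps power2_eq_square)
  \<comment> \<open>The factors \<open>c\<close> are the inverse cubes of the steps e / 3 for e =
    \<epsilon>, 2 \<epsilon>, 3 \<epsilon>. Only two derivatives are taken, so \<open>g''\<close>
    still contains \<open>F1\<close> and its increments are integrals of third differences of
    \<open>f\<close>.\<close>
  define g where "g x = 3 * P (27 / \<epsilon> ^ 3) F3 \<epsilon> 0 x - 3 * P (27 / (8 * \<epsilon> ^ 3)) F3 (2 * \<epsilon>) 0 x
      + P (1 / \<epsilon> ^ 3) F3 (3 * \<epsilon>) 0 x" for x
  define g' where "g' x = 3 * P (27 / \<epsilon> ^ 3) F2 \<epsilon> 1 x - 3 * P (27 / (8 * \<epsilon> ^ 3)) F2 (2 * \<epsilon>) 1 x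
      + P (1 / \<epsilon> ^ 3) F2 (3 * \<epsilon>) 1 x" for x
  define g'' where "g'' x = 3 * P (27 / \<epsilon> ^ 3) F1 \<epsilon> 2 x - 3 * P (27 / (8 * \<epsilon> ^ 3)) F1 (2 * \<epsilon>) 2 x
      + P (1 / \<epsilon> ^ 3) F1 (3 * \<epsilon>) 2 x" for x
  have g: "(g has_real_derivative g' x) (at x)" for x
    unfolding g_def g'_def by (rule derivative_eq_intros P0 refl)+ simp
  moreover have "(g' has_real_derivative g'' x) (at x)" for x
    unfolding g'_def g''_def by (rule derivative_eq_intros P1 refl)+ simp
  moreover have "integral {0..1} (\<lambda>x. \<bar>g x - f x\<bar>) \<le> 6 * W"
  proof -
    \<comment> \<open>The factor 3 = 27 / 9 plays the role of a crude bound for the density of the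
      B-spline weight. The double integral contributes another factor 2, whence 6.\<close>
    have pointwise: "\<bar>g x - f x\<bar> \<le> 3 * integral {0..1} (\<lambda>u. \<bar>D (\<epsilon> * (u - x)) x\<bar>)" for x
    proof -
      define y where "y k u = x + k * \<epsilon> * (u - x)" for k u :: real
      define K where "K u = 3 * F3 (y 1 u) / \<epsilon> ^ 3 - 3 * F3 (y 2 u) / (8 * \<epsilon> ^ 3)
          + F3 (y 3 u) / (27 * \<epsilon> ^ 3) - f x * u ^ 3 / 6" for u
      define K1 where "K1 u = 3 * F2 (y 1 u) / \<epsilon> ^ 2 - 3 * F2 (y 2 u) / (4 * \<epsilon> ^ 2)
          + F2 (y 3 u) / (9 * \<epsilon> ^ 2) - f x * u ^ 2 / 2" for u
      define K2 where "K2 u = 3 * F1 (y 1 u) / \<epsilon> - 3 * F1 (y 2 u) / (2 * \<epsilon>)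
          + F1 (y 3 u) / (3 * \<epsilon>) - f x * u" for u
      define k where "k u = 3 * f (y 1 u) - 3 * f (y 2 u) + f (y 3 u) - f x" for u
      have K: "(K has_real_derivative K1 u) (at u)" for u
        unfolding K_def K1_def y_def using e
        by (auto intro!: derivative_eq_intros chain simp: field_simps power2_eq_square power3_eq_cube)
      have K1: "(K1 has_real_derivative K2 u) (at u)" for u
        unfolding K1_def K2_def y_def using e
        by (auto intro!: derivative_eq_intros chain simp: field_simps power2_eq_square)
      have K2: "(K2 has_real_derivative k u) (at u)" for u
        unfolding K2_def k_def y_def using e
        by (auto intro!: derivative_eq_intros chain simp: field_simps)
      obtain u where u: "0 < u" "u < 2 / 3" and
        Keq: "K 1 - 3 * K (2 / 3) + 3 * K (1 / 3) - K 0 = (K2 (u + 1 / 3) - K2 u) / 9"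
        by (rule third_difference_mvt[of K K1 K2 "1 / 3" 0, OF K K1])
           (auto simp: power2_eq_square)
      have y: "y 1 0 = (1 - \<epsilon>) * x" "y 1 (1 / 3) = (1 - \<epsilon>) * x + \<epsilon> / 3"
        "y 1 (2 / 3) = (1 - \<epsilon>) * x + 2 * \<epsilon> / 3" "y 1 1 = (1 - \<epsilon>) * x + \<epsilon>"
        "y 2 0 = (1 - 2 * \<epsilon>) * x" "y 2 (1 / 3) = (1 - 2 * \<epsilon>) * x + 2 * \<epsilon> / 3"
        "y 2 (2 / 3) = (1 - 2 * \<epsilon>) * x + 2 * (2 * \<epsilon>) / 3" "y 2 1 = (1 - 2 * \<epsilon>) * x + 2 * \<epsilon>"
        "y 3 0 = (1 - 3 * \<epsilon>) * x" "y 3 (1 / 3) = (1 - 3 * \<epsilon>) * x + 3 * \<epsilon> / 3"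
        "y 3 (2 / 3) = (1 - 3 * \<epsilon>) * x + 2 * (3 * \<epsilon>) / 3" "y 3 1 = (1 - 3 * \<epsilon>) * x + 3 * \<epsilon>"
        by (auto simp: y_def algebra_simps)
      have "g x - f x = 27 * (K 1 - 3 * K (2 / 3) + 3 * K (1 / 3) - K 0)"
        unfolding g_def P_def K_def y using e by (simp add: field_simps power3_eq_cube)
      then have "g x - f x = 3 * (K2 (u + 1 / 3) - K2 u)"
        unfolding Keq by linarith
      then have eq: "\<bar>g x - f x\<bar> = 3 * \<bar>K2 (u + 1 / 3) - K2 u\<bar>"
        by (simp only: abs_mult abs_numeral)
      have "continuous_on UNIV k"
        unfolding k_def y_def by (intro continuous_intros f_cont)
      with K2 have "\<bar>K2 (u + 1 / 3) - K2 u\<bar> \<le> integral {0..1} (\<lambda>u. \<bar>k u\<bar>)"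
        using u by (intro abs_increment_le_integral) auto
      moreover have "k = (\<lambda>u. D (\<epsilon> * (u - x)) x)"
        by (auto simp: k_def D_def y_def mult.assoc)
      ultimately show ?thesis
        unfolding eq by simp
    qed
    have D_cont: "continuous_on UNIV (\<lambda>(h, x). \<bar>D h x\<bar>)"
      unfolding D_def case_prod_beta by (intro continuous_intros f_cont)
    have "continuous_on (cbox 0 1) (\<lambda>x. integral (cbox 0 1) ((\<lambda>x u. \<bar>D (\<epsilon> * (u - x)) x\<bar>) x))"
      by (rule integral_continuous_on_param)
         (unfold case_prod_beta D_def, intro f_cont continuous_intros)
    then have int: "(\<lambda>x. integral {0..1} (\<lambda>u. \<bar>D (\<epsilon> * (u - x)) x\<bar>)) integrable_on {0..1}"
      by (intro integrable_continuous_real) (simp add: cbox_interval)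
    have "integral {0..1} (\<lambda>x. \<bar>g x - f x\<bar>)
        \<le> integral {0..1} (\<lambda>x. 3 * integral {0..1} (\<lambda>u. \<bar>D (\<epsilon> * (u - x)) x\<bar>))"
    proof (rule integral_le)
      show "(\<lambda>x. \<bar>g x - f x\<bar>) integrable_on {0..1}"
        by (intro integrable_continuous_real continuous_intros f_cont continuous_on_if_deriv[OF g])
    qed (use integrable_on_cmult_left[OF int, of 3] pointwise in auto)
    also have "\<dots> = 3 * integral {0..1} (\<lambda>x. integral {0..1} (\<lambda>u. \<bar>D (\<epsilon> * (u - x)) x\<bar>))"
      by simp
    also have "\<dots> \<le> 3 * (2 * W)"
      using W e by (intro mult_left_mono integral_average_difference_le D_cont) (auto simp: D_def)
    finally show ?thesis by simp
  qed
  moreover have "\<bar>g'' x - g'' y\<bar> \<le> 93 * W / \<epsilon> ^ 3" if x: "x \<in> {0..1}" and y: "y \<in> {0..1}" for x y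
  proof -
    have P_le: "\<bar>P c F1 e 2 x - P c F1 e 2 y\<bar> \<le> c * W" if e': "0 < e" "e \<le> 3 * \<epsilon>" "0 \<le> c" for c e
    proof -
      \<comment> \<open>The derivative of \<open>Q\<close> is the third difference of
        \<open>f\<close> with step \<open>e / 3\<close>, at most \<epsilon>, and
        \<open>{0..1 - e}\<close> is exactly the domain on which \<open>W\<close> bounds its
        integral.\<close>
      define Q where "Q z = F1 (z + e) - 3 * F1 (z + 2 * e / 3) + 3 * F1 (z + e / 3) - F1 z" for z
      have Q: "(Q has_real_derivative D (e / 3) z) (at z)" for z
        unfolding Q_def D_def by (auto intro!: derivative_eq_intros chain simp: algebra_simps)
      have sub: "(1 - e) * z \<in> {0..1 - e}" if "z \<in> {0..1}" for z
        using that e e' mult_left_mono[of z 1 "1 - e"] by auto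
      have "\<bar>Q ((1 - e) * x) - Q ((1 - e) * y)\<bar> \<le> integral {0..1 - e} (\<lambda>x. \<bar>D (e / 3) x\<bar>)"
        by (intro abs_increment_le_integral[OF Q] sub x y)
           (auto simp: D_def intro!: continuous_intros f_cont)
      also have "{0..1 - e} = {x \<in> {0..1}. x + 3 * (e / 3) \<in> {0..1}}"
        using e e' by auto
      also have "integral \<dots> (\<lambda>x. \<bar>D (e / 3) x\<bar>) \<le> W"
        using e e' unfolding D_def by (intro W) auto
      finally have "(1 - e)\<^sup>2 * \<bar>Q ((1 - e) * x) - Q ((1 - e) * y)\<bar> \<le> 1 * W"
        using e e' by (intro mult_mono) (auto simp: power_le_one)
      then have "c * ((1 - e)\<^sup>2 * \<bar>Q ((1 - e) * x) - Q ((1 - e) * y)\<bar>) \<le> c * (1 * W)"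
        using e' by (intro mult_left_mono)
      moreover have "P c F1 e 2 z = c * (1 - e)\<^sup>2 * Q ((1 - e) * z)" for z
        by (simp add: P_def Q_def)
      ultimately show ?thesis
        using e' by (simp add: abs_mult flip: right_diff_distrib)
    qed
    have triangle: "\<bar>3 * a - 3 * b + c - (3 * a' - 3 * b' + c')\<bar>
        \<le> 3 * \<bar>a - a'\<bar> + 3 * \<bar>b - b'\<bar> + \<bar>c - c'\<bar>" for a b c a' b' c' :: real
      by (auto simp: abs_if)
    have "\<bar>g'' x - g'' y\<bar> \<le> 3 * \<bar>P (27 / \<epsilon> ^ 3) F1 \<epsilon> 2 x - P (27 / \<epsilon> ^ 3) F1 \<epsilon> 2 y\<bar>
        + 3 * \<bar>P (27 / (8 * \<epsilon> ^ 3)) F1 (2 * \<epsilon>) 2 x - P (27 / (8 * \<epsilon> ^ 3)) F1 (2 * \<epsilon>) 2 y\<bar>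
        + \<bar>P (1 / \<epsilon> ^ 3) F1 (3 * \<epsilon>) 2 x - P (1 / \<epsilon> ^ 3) F1 (3 * \<epsilon>) 2 y\<bar>"
      unfolding g''_def by (rule triangle)
    also have "\<dots> \<le> 3 * (27 / \<epsilon> ^ 3 * W) + 3 * (27 / (8 * \<epsilon> ^ 3) * W) + 1 / \<epsilon> ^ 3 * W"
      using e by (intro add_mono mult_left_mono P_le) auto
    also have "\<dots> = (737 / 8) * W / \<epsilon> ^ 3"
      using e by (simp add: field_simps)
    \<comment> \<open>Rounding 81 + 81/8 + 1 up to 93 requires \<open>0 \<le> W\<close>, which holds
      since \<open>W\<close> bounds an absolute value.\<close>
    also have "\<dots> \<le> 93 * W / \<epsilon> ^ 3"
    proof -
      have "0 \<le> \<bar>P 1 F1 \<epsilon> 2 x - P 1 F1 \<epsilon> 2 y\<bar>" by simp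
      also have "\<dots> \<le> 1 * W" using e by (intro P_le) auto
      finally show ?thesis using e by (intro divide_right_mono mult_right_mono) auto
    qed
    finally show ?thesis .
  qed
  ultimately show thesis
    by (rule that)
qed

subsection \<open>Operators on smooth functions\<close>

text \<open>The filter unifies the two settings: the principal filter of the unit interval for
  continuous functions, the almost-everywhere filter for integrable ones. Closure under countable
  conjunctions, \<open>eventually_countable\<close>, carries the argument with countably many
  nodes.\<close>

locale korovkin_operator =
  fixes E :: "(real \<Rightarrow> real) set" and F :: "real filter" and T :: "(real \<Rightarrow> real) \<Rightarrow> real \<Rightarrow> real"
  assumes continuous_in: "continuous_on {0..1} f \<Longrightarrow> f \<in> E"
    and add_in: "f \<in> E \<Longrightarrow> g \<in> E \<Longrightarrow> (\<lambda>x. f x + g x) \<in> E"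
    and scale_in: "f \<in> E \<Longrightarrow> (\<lambda>x. c * f x) \<in> E"
    and eventually_unit: "\<forall>\<^sub>F x in F. x \<in> {0..1}"
    and eventually_countable: "(\<And>i::nat. \<forall>\<^sub>F x in F. P i x) \<Longrightarrow> \<forall>\<^sub>F x in F. \<forall>i. P i x"
    and T_add: "f \<in> E \<Longrightarrow> g \<in> E \<Longrightarrow> \<forall>\<^sub>F x in F. T (\<lambda>x. f x + g x) x \<le> T f x + T g x"
    and T_scale: "f \<in> E \<Longrightarrow> \<alpha> \<ge> 0 \<Longrightarrow> \<forall>\<^sub>F x in F. T (\<lambda>x. \<alpha> * f x) x = \<alpha> * T f x"
    and T_mono: "f \<in> E \<Longrightarrow> g \<in> E \<Longrightarrow> \<forall>\<^sub>F x in F. f x \<le> g x \<Longrightarrow> \<forall>\<^sub>F x in F. T f x \<le> T g x"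
    and T_shift: "f \<in> E \<Longrightarrow> \<forall>\<^sub>F x in F. T (\<lambda>x. f x + \<alpha>) x = T f x + \<alpha> * T (\<lambda>_. 1) x"
begin

lemma uminus_in: "f \<in> E \<Longrightarrow> (\<lambda>x. - f x) \<in> E"
  using scale_in[of f "-1"] by simp

lemma diff_in: "f \<in> E \<Longrightarrow> g \<in> E \<Longrightarrow> (\<lambda>x. f x - g x) \<in> E"
  using add_in[OF _ uminus_in, of f g] by simp

lemma T_diff:
  assumes "f \<in> E" "g \<in> E"
  shows "\<forall>\<^sub>F x in F. T f x - T g x \<le> T (\<lambda>x. f x - g x) x"
  using T_add[OF diff_in[OF assms] assms(2)] by (simp add: algebra_simps)

lemma T_zero: "\<forall>\<^sub>F x in F. T (\<lambda>_. 0) x = 0"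
  using T_scale[of "\<lambda>_. 0" 0] continuous_in by simp

text \<open>From \<open>0 = T 0 \<le> T f + T (- f)\<close>; this inequality replaces
  oddness.\<close>

lemma T_uminus:
  assumes "f \<in> E"
  shows "\<forall>\<^sub>F x in F. - T f x \<le> T (\<lambda>x. - f x) x"
  using T_diff[OF continuous_in[OF continuous_on_const] assms, of 0] T_zero by eventually_elim auto

text \<open>Monotonicity bounds both \<open>T f\<close> and \<open>T (- f)\<close> by
  \<open>T g\<close>, and \<open>- T f\<close> lies below the latter.\<close>

lemma T_dominated:
  assumes f: "f \<in> E" and g: "g \<in> E" and le: "\<forall>\<^sub>F x in F. \<bar>f x\<bar> \<le> g x"
  shows "\<forall>\<^sub>F x in F. \<bar>T f x\<bar> \<le> T g x"
proof -
  have "\<forall>\<^sub>F x in F. T f x \<le> T g x"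
    using le by (intro T_mono f g) (auto elim: eventually_mono)
  moreover have "\<forall>\<^sub>F x in F. T (\<lambda>x. - f x) x \<le> T g x"
    using le by (intro T_mono f g uminus_in) (auto elim: eventually_mono)
  ultimately show ?thesis
    using T_uminus[OF f] by eventually_elim auto
qed

text \<open>Subadditivity gives \<open>T f - T g \<le> T (f - g) \<le> T d\<close>, and likewise
  with \<open>f\<close> and \<open>g\<close> exchanged. The majorant \<open>d\<close> is a
  parameter: a constant serves in the maximum norm, the absolute value of the difference in the
  mean.\<close>

lemma T_lipschitz:
  assumes f: "f \<in> E" and g: "g \<in> E" and d: "d \<in> E" and le: "\<forall>\<^sub>F x in F. \<bar>f x - g x\<bar> \<le> d x"
  shows "\<forall>\<^sub>F x in F. \<bar>T f x - T g x\<bar> \<le> T d x"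
proof -
  have "\<forall>\<^sub>F x in F. T (\<lambda>x. f x - g x) x \<le> T d x" "\<forall>\<^sub>F x in F. T (\<lambda>x. g x - f x) x \<le> T d x"
    using le by (intro T_mono f g d diff_in; force elim: eventually_mono)+
  then show ?thesis
    using T_diff[OF f g] T_diff[OF g f] by eventually_elim auto
qed

text \<open>Keeping the four errors at a point together allows one pointwise estimate for both
  spaces; passing to either norm then costs at most 4 \<lambda>.\<close>

definition test_error :: "real \<Rightarrow> real" where
  "test_error x = \<bar>T (\<lambda>_. 1) x - 1\<bar> + \<bar>T (\<lambda>t. t) x - x\<bar> + \<bar>T (\<lambda>t. - t) x + x\<bar>
    + \<bar>T (\<lambda>t. t\<^sup>2) x - x\<^sup>2\<bar>"

text \<open>Only nonnegative factors can be pulled out of \<open>T\<close>, which forces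
  \<open>0 \<le> a\<close>. The linear term is split into its positive and negative parts, the
  latter acting on \<open>- t\<close>; the constant term may have either sign by
  translatability.\<close>

lemma T_quadratic_le:
  assumes a: "0 \<le> a" "a \<le> B" and c: "\<bar>c\<bar> \<le> B" and d: "\<bar>d\<bar> \<le> B"
  shows "\<forall>\<^sub>F y in F. T (\<lambda>t. a * t\<^sup>2 + c * t + d) y \<le> a * y\<^sup>2 + c * y + d + B * test_error y"
proof -
  note in_E = continuous_in continuous_on_add continuous_on_mult continuous_on_const continuous_on_id
    continuous_on_power continuous_on_minus
  define p m where "p = max c 0" and "m = max (- c) 0"
  have pm: "p \<ge> 0" "m \<ge> 0" "c = p - m" "p \<le> B" "m \<le> B" "B \<ge> 0"
    using c by (auto simp: p_def m_def)
  have "\<forall>\<^sub>F y in F. T (\<lambda>t. a * t\<^sup>2 + c * t + d) y = T (\<lambda>t. a * t\<^sup>2 + c * t) y + d * T (\<lambda>_. 1) y"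
    by (rule T_shift) (intro in_E)
  moreover have "\<forall>\<^sub>F y in F. T (\<lambda>t. a * t\<^sup>2 + c * t) y \<le> T (\<lambda>t. a * t\<^sup>2) y + T (\<lambda>t. c * t) y"
    by (rule T_add; intro in_E)
  moreover have "\<forall>\<^sub>F y in F. T (\<lambda>t. c * t) y \<le> T (\<lambda>t. p * t) y + T (\<lambda>t. m * (- t)) y"
    using T_add[of "\<lambda>t. p * t" "\<lambda>t. m * (- t)", OF continuous_in continuous_in]
    unfolding pm(3) by (simp add: continuous_intros algebra_simps)
  moreover have "\<forall>\<^sub>F y in F. T (\<lambda>t. a * t\<^sup>2) y = a * T (\<lambda>t. t\<^sup>2) y"
    by (rule T_scale) (intro in_E a)+
  moreover have "\<forall>\<^sub>F y in F. T (\<lambda>t. p * t) y = p * T (\<lambda>t. t) y"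
    by (rule T_scale) (intro in_E pm)+
  moreover have "\<forall>\<^sub>F y in F. T (\<lambda>t. m * (- t)) y = m * T (\<lambda>t. - t) y"
    by (rule T_scale) (intro in_E pm)+
  ultimately show ?thesis
  proof eventually_elim
    case (elim y)
    let ?D0 = "T (\<lambda>_. 1) y - 1" and ?D1 = "T (\<lambda>t. t) y - y" and ?D1' = "T (\<lambda>t. - t) y + y"
      and ?D2 = "T (\<lambda>t. t\<^sup>2) y - y\<^sup>2"
    have mult: "s * z \<le> B * \<bar>z\<bar>" if "\<bar>s\<bar> \<le> B" for s z :: real
      using abs_ge_self[of "s * z"] mult_right_mono[OF that, of "\<bar>z\<bar>"] by (simp add: abs_mult)
    have "a * ?D2 \<le> B * \<bar>?D2\<bar>" "p * ?D1 \<le> B * \<bar>?D1\<bar>" "m * ?D1' \<le> B * \<bar>?D1'\<bar>" "d * ?D0 \<le> B * \<bar>?D0\<bar>"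
      using a pm d by (intro mult; simp)+
    then show ?case
      using elim unfolding pm(3) test_error_def by (simp add: algebra_simps)
  qed
qed

text \<open>At \<open>y\<close>, the majorant touching \<open>g\<close> at \<open>x\<close> exceeds
  \<open>g\<close> by at most \<open>K * (y - x)\<^sup>2\<close>: one half is its own quadratic
  term, the other the Taylor remainder. The factor 5 / 2 comes from its constant coefficient,
  bounded by \<open>K + K + K / 2\<close>.\<close>

lemma smooth_upper_estimate:
  assumes g: "\<And>x. (g has_real_derivative g' x) (at x)"
    and g': "\<And>x. (g' has_real_derivative g'' x) (at x)"
    and K: "\<And>x. x \<in> {0..1} \<Longrightarrow> \<bar>g x\<bar> \<le> K" "\<And>x. x \<in> {0..1} \<Longrightarrow> \<bar>g' x\<bar> \<le> K"
      "\<And>x. x \<in> {0..1} \<Longrightarrow> \<bar>g'' x\<bar> \<le> K"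
  shows "\<forall>\<^sub>F y in F. T g y \<le> g y + 5 / 2 * K * test_error y"
proof -
  have K0: "0 \<le> K" using K(1)[of 0] by simp
  have at_node: "\<forall>\<^sub>F y in F. T g y \<le> g y + K * (y - x)\<^sup>2 + 5 / 2 * K * test_error y" if x: "x \<in> {0..1}" for x
  proof -
    define c d where "c = g' x - K * x" and "d = g x - g' x * x + K / 2 * x\<^sup>2"
    have poly: "K / 2 * t\<^sup>2 + c * t + d = g x + g' x * (t - x) + K / 2 * (t - x)\<^sup>2" for t
      by (simp add: c_def d_def power2_eq_square field_simps)
    have "K * x \<le> K * 1" "\<bar>g' x\<bar> * \<bar>x\<bar> \<le> K * 1" "K * x\<^sup>2 \<le> K * 1"
      using K[OF x] x K0 by (intro mult_mono; auto simp: power_le_one)+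
    moreover have "0 \<le> K * x" "0 \<le> K * x\<^sup>2" "\<bar>g' x * x\<bar> = \<bar>g' x\<bar> * \<bar>x\<bar>"
      using K0 x by (auto simp: abs_mult)
    ultimately have cd: "\<bar>c\<bar> \<le> 5 / 2 * K" "\<bar>d\<bar> \<le> 5 / 2 * K"
      using K[OF x] unfolding c_def d_def by linarith+
    have "\<forall>\<^sub>F y in F. T g y \<le> T (\<lambda>t. K / 2 * t\<^sup>2 + c * t + d) y"
    proof (rule T_mono)
      show "g \<in> E" by (rule continuous_in) (rule continuous_on_if_deriv[OF g])
      show "(\<lambda>t. K / 2 * t\<^sup>2 + c * t + d) \<in> E"
        by (intro continuous_in continuous_intros)
      show "\<forall>\<^sub>F t in F. g t \<le> K / 2 * t\<^sup>2 + c * t + d"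
        using eventually_unit
      proof eventually_elim
        case (elim t)
        then show ?case
          using taylor_quadratic_bound[OF g g' K(3) x elim] unfolding poly by linarith
      qed
    qed
    moreover have "\<forall>\<^sub>F y in F. T (\<lambda>t. K / 2 * t\<^sup>2 + c * t + d) y
        \<le> K / 2 * y\<^sup>2 + c * y + d + 5 / 2 * K * test_error y"
      using K0 cd by (intro T_quadratic_le) auto
    ultimately show ?thesis
      using eventually_unit
    proof eventually_elim
      case (elim y)
      then show ?case
        using elim(1,2) taylor_quadratic_bound[OF g g' K(3) x elim(3)] unfolding poly[of y] by linarith
    qed
  qed
  \<comment> \<open>An enumeration of the rationals. The exceptional set depends on the node, so
    only countably many nodes may be treated before \<open>y\<close> is fixed; nodes tending to
    \<open>y\<close> then remove the quadratic term.\<close>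
  define q :: "nat \<Rightarrow> real" where "q i = of_rat (from_nat i)" for i
  have "\<forall>\<^sub>F y in F. \<forall>i. q i \<in> {0..1} \<longrightarrow> T g y \<le> g y + K * (y - q i)\<^sup>2 + 5 / 2 * K * test_error y"
    by (rule eventually_countable) (use at_node in auto)
  with eventually_unit show ?thesis
  proof eventually_elim
    case (elim y)
    have node: "\<exists>i. q i \<in> {0..1} \<and> \<bar>y - q i\<bar> < d" if d: "d > 0" for d
    proof -
      have "max 0 (y - d) < min 1 (y + d)" using elim(1) d by auto
      then obtain r where r: "max 0 (y - d) < of_rat r" "of_rat r < min 1 (y + d)"
        using of_rat_dense by blast
      then show ?thesis
        by (intro exI[of _ "to_nat r"]) (auto simp: q_def)
    qed
    have "\<exists>i. q i \<in> {0..1} \<and> \<bar>y - q i\<bar> < inverse (real (Suc n))" for n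
      by (rule node) simp
    then obtain j where j: "\<And>n. q (j n) \<in> {0..1}" "\<And>n. \<bar>y - q (j n)\<bar> < inverse (real (Suc n))"
      by metis
    have "(\<lambda>n. y - q (j n)) \<longlonglongrightarrow> 0"
      by (rule Lim_null_comparison[OF _ LIMSEQ_inverse_real_of_nat])
         (intro always_eventually allI, simp only: real_norm_def j(2)[THEN less_imp_le])
    then have "(\<lambda>n. g y + K * (y - q (j n))\<^sup>2 + 5 / 2 * K * test_error y)
        \<longlonglongrightarrow> g y + K * 0\<^sup>2 + 5 / 2 * K * test_error y"
      by (intro tendsto_intros)
    then have "T g y \<le> g y + K * 0\<^sup>2 + 5 / 2 * K * test_error y"
      by (rule LIMSEQ_le_const) (use elim(2) j(1) in auto)
    then show ?case by simp
  qed
qed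

lemma smooth_estimate:
  assumes g: "\<And>x. (g has_real_derivative g' x) (at x)"
    and g': "\<And>x. (g' has_real_derivative g'' x) (at x)"
    and K: "\<And>x. x \<in> {0..1} \<Longrightarrow> \<bar>g x\<bar> \<le> K" "\<And>x. x \<in> {0..1} \<Longrightarrow> \<bar>g' x\<bar> \<le> K"
      "\<And>x. x \<in> {0..1} \<Longrightarrow> \<bar>g'' x\<bar> \<le> K"
  shows "\<forall>\<^sub>F y in F. \<bar>g y - T g y\<bar> \<le> 5 / 2 * K * test_error y"
proof -
  have "\<forall>\<^sub>F y in F. T (\<lambda>x. - g x) y \<le> - g y + 5 / 2 * K * test_error y"
    using K by (intro smooth_upper_estimate[of _ "\<lambda>x. - g' x" "\<lambda>x. - g'' x"] DERIV_minus g g') auto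
  moreover have "\<forall>\<^sub>F y in F. T g y \<le> g y + 5 / 2 * K * test_error y"
    by (rule smooth_upper_estimate[OF g g' K])
  moreover have "\<forall>\<^sub>F y in F. - T g y \<le> T (\<lambda>x. - g x) y"
    by (intro T_uminus continuous_in continuous_on_if_deriv[OF g])
  ultimately show ?thesis
    by eventually_elim linarith
qed

end

subsection \<open>The maximum norm\<close>

text \<open>The hypothesis \<open>0 \<le> B\<close> covers null sets \<open>A\<close>, where the
  essential supremum is -\<infinity> and the norm is 0.\<close>

lemma Lp_norm_on_infinity_le:
  assumes q: "q \<in> borel_measurable (lebesgue_on A)" and A: "A \<in> sets lebesgue"
    and B: "0 \<le> B" "\<And>x. x \<in> A \<Longrightarrow> \<bar>q x\<bar> \<le> B"
  shows "Lp_norm_on \<infinity> A q \<le> B"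
proof -
  have "AE x in lebesgue_on A. ereal \<bar>q x\<bar> \<le> ereal B"
    using B A by (intro AE_I2) (auto simp: space_restrict_space)
  then have "esssup (lebesgue_on A) (\<lambda>x. ereal \<bar>q x\<bar>) \<le> ereal B"
    using q by (intro esssup_I) auto
  then show ?thesis
    using B(1) by (cases "esssup (lebesgue_on A) (\<lambda>x. ereal \<bar>q x\<bar>)") (auto simp: Lp_norm_on_def)
qed

text \<open>The set where the absolute value is at most the essential supremum is closed in the
  interval and contains almost every interior point, hence every point. Positive length matters: on
  a single point the norm is 0 whatever the value.\<close>

lemma abs_le_Lp_norm_on_infinity:
  assumes q: "continuous_on {a..b} q" and ab: "a < b" and x: "x \<in> {a..b}"
  shows "\<bar>q x\<bar> \<le> Lp_norm_on \<infinity> {a..b} q"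
proof -
  let ?M = "lebesgue_on {a..b}"
  define e where "e = esssup ?M (\<lambda>x. ereal \<bar>q x\<bar>)"
  have cont: "continuous_on {a..b} (\<lambda>x. \<bar>q x\<bar>)"
    using q by (intro continuous_intros)
  have meas: "q \<in> borel_measurable ?M"
    using q by (intro continuous_imp_measurable_on_sets_lebesgue) auto
  obtain B where B: "\<And>x. x \<in> {a..b} \<Longrightarrow> \<bar>q x\<bar> \<le> B"
    using compact_imp_bounded[OF compact_continuous_image[OF q compact_Icc], unfolded bounded_iff]
    by (metis imageI real_norm_def)
  have "AE x in ?M. ereal \<bar>q x\<bar> \<le> ereal B"
    using B by (intro AE_I2) (auto simp: space_restrict_space)
  then have upper: "e \<le> ereal B"
    using meas unfolding e_def by (intro esssup_I) auto
  have nontriv: "emeasure ?M (space ?M) \<noteq> 0"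
    using ab by (simp add: space_restrict_space emeasure_restrict_space)
  have "esssup ?M (\<lambda>_. 0::ereal) \<le> e"
    unfolding e_def by (rule esssup_mono) auto
  then have "0 \<le> e"
    using esssup_const[OF nontriv, of "0::ereal"] by simp
  with upper obtain c where c: "e = ereal c"
    by (cases e) auto
  have "AE x in ?M. \<bar>q x\<bar> \<le> c"
    using esssup_AE[of "\<lambda>x. ereal \<bar>q x\<bar>" ?M] c by (simp add: e_def)
  then have "AE x in lebesgue. x \<in> {a..b} \<longrightarrow> \<bar>q x\<bar> \<le> c"
    by (subst (asm) AE_restrict_space_iff) auto
  then have ae: "AE x \<in> {a<..<b} in lebesgue. x \<in> {x\<in>{a..b}. \<bar>q x\<bar> \<le> c}"
    by (auto elim!: eventually_mono)
  have cl: "closed {x\<in>{a..b}. \<bar>q x\<bar> \<le> c}"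
    using continuous_closed_preimage[OF cont, of "{..c}"]
    by (auto simp: vimage_def Int_def intro: back_subst[of closed])
  have "closure {a<..<b} \<subseteq> {x\<in>{a..b}. \<bar>q x\<bar> \<le> c}"
    using mem_closed_if_AE_lebesgue_open[OF open_greaterThanLessThan cl ae]
    by (intro closure_minimal[OF _ cl]) blast
  then have "\<bar>q x\<bar> \<le> c"
    using x ab by auto
  then show ?thesis
    using c by (simp add: Lp_norm_on_def e_def)
qed

lemma abs_le_Lp_norm_infinity: "f \<in> C_01 \<Longrightarrow> x \<in> {0..1} \<Longrightarrow> \<bar>f x\<bar> \<le> Lp_norm \<infinity> f"
  by (rule abs_le_Lp_norm_on_infinity) (auto simp: C_01_def)

lemma Lp_norm_infinity_le:
  assumes f: "f \<in> C_01" and B: "\<And>x. x \<in> {0..1} \<Longrightarrow> \<bar>f x\<bar> \<le> B"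
  shows "Lp_norm \<infinity> f \<le> B"
proof (rule Lp_norm_on_infinity_le)
  show "f \<in> borel_measurable (lebesgue_on {0..1})"
    using f by (intro continuous_imp_measurable_on_sets_lebesgue) (auto simp: C_01_def)
  show "0 \<le> B" using B[of 0] by simp
qed (use B in auto)

section \<open>Finite differences and the modulus of smoothness\<close>

lemma finite_diff_2: "finite_diff 2 h f x = f (x + 2 * h) - 2 * f (x + h) + f x"
  by (simp add: finite_diff_def numeral_2_eq_2)

lemma finite_diff_3:
  "finite_diff 3 h f x = f (x + 3 * h) - 3 * f (x + 2 * h) + 3 * f (x + h) - f x"
  by (simp add: finite_diff_def numeral_3_eq_3 numeral_2_eq_2)

lemma difference_domain_eq:
  "{x \<in> {0..1}. x + real r * h \<in> {0..1}} = {max 0 (- (real r * h))..min 1 (1 - real r * h)}"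
  by auto

lemma intermediate_node_in_unit:
  fixes x h :: real
  assumes "x \<in> {0..1}" "x + s * h \<in> {0..1}" "0 \<le> t" "t \<le> s"
  shows "x + t * h \<in> {0..1}"
proof (cases "h \<ge> 0")
  case True
  then have "0 \<le> t * h" "t * h \<le> s * h" using assms by (auto intro: mult_right_mono)
  then show ?thesis using assms by auto
next
  case False
  then have "t * h \<le> 0" "s * h \<le> t * h" using assms by (auto intro: mult_right_mono_neg mult_nonneg_nonpos)
  then show ?thesis using assms by auto
qed

text \<open>The bound, with 4 = 1 + 2 + 1, is uniform in \<open>h\<close>, so the supremum defining
  the modulus is a genuine upper bound. Continuity allows the norm of the difference to be compared
  with its values.\<close>

lemma second_difference_bounds:
  assumes f: "f \<in> C_01"
  shows "Lp_norm_on \<infinity> {x\<in>{0..1}. x + real 2 * h \<in> {0..1}} (finite_diff 2 h f) \<le> 4 * Lp_norm \<infinity> f"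
    and "continuous_on {x\<in>{0..1}. x + real 2 * h \<in> {0..1}} (finite_diff 2 h f)"
proof -
  let ?A = "{x\<in>{0..1}. x + real 2 * h \<in> {0..1}}"
  have nodes: "x + 2 * h \<in> {0..1}" "x + h \<in> {0..1}" "x \<in> {0..1}" if "x \<in> ?A" for x
    using intermediate_node_in_unit[of x 2 h 1] that by auto
  have "continuous_on {0..1} f" using f by (simp add: C_01_def)
  then have comp: "continuous_on ?A (\<lambda>x. f (p x))" if "continuous_on ?A p" "p ` ?A \<subseteq> {0..1}" for p
    using continuous_on_compose2 that by blast
  show cont: "continuous_on ?A (finite_diff 2 h f)"
    unfolding finite_diff_2[abs_def] using nodes
    by (intro continuous_intros comp) auto
  have "0 \<le> Lp_norm \<infinity> f"
    using abs_le_Lp_norm_infinity[OF f, of 0] by simp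
  moreover have "\<bar>finite_diff 2 h f x\<bar> \<le> 4 * Lp_norm \<infinity> f" if "x \<in> ?A" for x
    using nodes[OF that, THEN abs_le_Lp_norm_infinity[OF f]] unfolding finite_diff_2 by linarith
  moreover have "?A \<in> sets lebesgue"
    unfolding difference_domain_eq by simp
  ultimately show "Lp_norm_on \<infinity> ?A (finite_diff 2 h f) \<le> 4 * Lp_norm \<infinity> f"
    by (intro Lp_norm_on_infinity_le continuous_imp_measurable_on_sets_lebesgue cont) auto
qed

text \<open>For a step of absolute value 1/2 the domain shrinks to one point and the norm over it is
  0; the strict bound on \<open>h\<close> keeps the interval nondegenerate.\<close>

lemma second_difference_le_modulus:
  assumes f: "f \<in> C_01" and h: "\<bar>h\<bar> \<le> \<delta>" "\<bar>h\<bar> < 1 / 2" and x: "x \<in> {0..1}" "x + 2 * h \<in> {0..1}"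
  shows "\<bar>f (x + 2 * h) - 2 * f (x + h) + f x\<bar> \<le> modulus_of_smoothness 2 \<infinity> f \<delta>"
proof -
  have "\<bar>finite_diff 2 h f x\<bar> \<le> Lp_norm_on \<infinity> {x\<in>{0..1}. x + real 2 * h \<in> {0..1}} (finite_diff 2 h f)"
    using second_difference_bounds(2)[OF f, of h] h x unfolding difference_domain_eq
    by (intro abs_le_Lp_norm_on_infinity) auto
  also have "\<dots> \<le> modulus_of_smoothness 2 \<infinity> f \<delta>"
    unfolding modulus_of_smoothness_def using h second_difference_bounds(1)[OF f]
    by (intro cSUP_upper bdd_aboveI2[where M = "4 * Lp_norm \<infinity> f"]) auto
  finally show ?thesis by (simp add: finite_diff_2)
qed

lemma uniform_continuity_unit:
  fixes f :: "real \<Rightarrow> real"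
  assumes "continuous_on {0..1} f" "\<eta> > 0"
  obtains \<epsilon> where "0 < \<epsilon>" "\<epsilon> \<le> 1 / 3"
    "\<And>x y. x \<in> {0..1} \<Longrightarrow> y \<in> {0..1} \<Longrightarrow> \<bar>x - y\<bar> \<le> \<epsilon> \<Longrightarrow> \<bar>f x - f y\<bar> \<le> \<eta>"
proof -
  have "uniformly_continuous_on {0..1} f"
    using assms compact_uniformly_continuous by blast
  then obtain d where d: "d > 0"
      "\<And>x y. x \<in> {0..1} \<Longrightarrow> y \<in> {0..1} \<Longrightarrow> dist y x < d \<Longrightarrow> dist (f y) (f x) < \<eta>"
    unfolding uniformly_continuous_on_def using \<open>\<eta> > 0\<close> by blast
  show thesis
  proof (rule that[of "min (d / 2) (1 / 3)"])
    fix x y :: real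
    assume xy: "x \<in> {0..1}" "y \<in> {0..1}" "\<bar>x - y\<bar> \<le> min (d / 2) (1 / 3)"
    then show "\<bar>f x - f y\<bar> \<le> \<eta>"
      using d(2)[OF xy(2,1)] d(1) by (auto simp: dist_real_def)
  qed (use d in auto)
qed

section \<open>Operators on continuous functions\<close>

locale korovkin_operator_C =
  fixes T :: "(real \<Rightarrow> real) \<Rightarrow> real \<Rightarrow> real"
  assumes T_in: "T \<in> C_01 \<rightarrow> C_01" and sublinear: "sublinear_on C_01 le_C T"
    and monotone: "monotone_on C_01 le_C le_C T"
    and translatable: "strongly_translatable_on C_01 le_C T"

sublocale korovkin_operator_C \<subseteq> korovkin_operator C_01 "principal {0..1}" T
proof
  fix f g :: "real \<Rightarrow> real" and \<alpha> :: real
  show "f \<in> C_01 \<Longrightarrow> g \<in> C_01 \<Longrightarrow> \<forall>\<^sub>F x in principal {0..1}. f x \<le> g x \<Longrightarrow>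
      \<forall>\<^sub>F x in principal {0..1}. T f x \<le> T g x"
    using monotone by (auto simp: monotone_on_def le_C_def eventually_principal)
  show "f \<in> C_01 \<Longrightarrow> \<forall>\<^sub>F x in principal {0..1}. T (\<lambda>x. f x + \<alpha>) x = T f x + \<alpha> * T (\<lambda>_. 1) x"
    using translatable
    by (auto simp: strongly_translatable_on_def le_C_def eq_by_def eventually_principal intro: antisym)
qed (use sublinear in \<open>auto simp: sublinear_on_def le_C_def eq_by_def eventually_principal C_01_def
    intro: antisym continuous_intros\<close>)

context korovkin_operator_C
begin

abbreviation "L \<equiv> op_norm \<infinity> C_01 T"

text \<open>On the unit ball \<open>T f\<close> is dominated by \<open>T 1\<close>. So the norms are
  bounded above, and their supremum bounds the one attained at the constant function 1.\<close>

lemma T_one_le_op_norm: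
  assumes x: "x \<in> {0..1}"
  shows "\<bar>T (\<lambda>_. 1) x\<bar> \<le> L"
proof -
  have one: "(\<lambda>_. 1) \<in> C_01" by (simp add: C_01_def)
  have "Lp_norm \<infinity> (T f) \<le> Lp_norm \<infinity> (T (\<lambda>_. 1))" if f: "f \<in> C_01" "Lp_norm \<infinity> f \<le> 1" for f
  proof (rule Lp_norm_infinity_le)
    show "T f \<in> C_01" using f T_in by auto
    fix y :: real assume y: "y \<in> {0..1}"
    have "\<bar>T f y\<bar> \<le> T (\<lambda>_. 1) y"
      using T_dominated[OF f(1) one] abs_le_Lp_norm_infinity[OF f(1)] f(2) y
      by (force simp: eventually_principal)
    also have "\<dots> \<le> Lp_norm \<infinity> (T (\<lambda>_. 1))"
      using abs_le_Lp_norm_infinity[OF funcset_mem[OF T_in one] y] by linarith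
    finally show "\<bar>T f y\<bar> \<le> Lp_norm \<infinity> (T (\<lambda>_. 1))" .
  qed
  moreover have "Lp_norm \<infinity> (\<lambda>_. 1) \<le> 1"
    by (rule Lp_norm_infinity_le) (auto simp: one)
  ultimately have "Lp_norm \<infinity> (T (\<lambda>_. 1)) \<le> L"
    unfolding op_norm_def using one by (intro cSUP_upper bdd_aboveI2) auto
  then show ?thesis
    using abs_le_Lp_norm_infinity[OF funcset_mem[OF T_in one] x] by linarith
qed

lemma op_norm_nonneg: "0 \<le> L"
  using T_one_le_op_norm[of 0] by simp

lemma T_abs_le:
  assumes f: "f \<in> C_01" and B: "\<And>x. x \<in> {0..1} \<Longrightarrow> \<bar>f x\<bar> \<le> B" and x: "x \<in> {0..1}"
  shows "T (\<lambda>_. B) x \<le> L * B" "\<bar>T f x\<bar> \<le> L * B"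
proof -
  have "0 \<le> B" using B[of 0] by simp
  have "T (\<lambda>_. B * 1) x = B * T (\<lambda>_. 1) x"
    using T_scale[OF _ \<open>0 \<le> B\<close>, of "\<lambda>_. 1"] x continuous_in by (simp add: eventually_principal)
  also have "\<dots> \<le> B * L"
    using T_one_le_op_norm[OF x] \<open>0 \<le> B\<close> by (intro mult_left_mono) auto
  finally show "T (\<lambda>_. B) x \<le> L * B" by (simp add: mult.commute)
  moreover have "\<bar>T f x\<bar> \<le> T (\<lambda>_. B) x"
    using T_dominated[OF f, of "\<lambda>_. B"] B x continuous_in by (auto simp: eventually_principal)
  ultimately show "\<bar>T f x\<bar> \<le> L * B" by simp
qed

lemma test_error_le:
  assumes "x \<in> {0..1}"
  shows "test_error x \<le> 4 * korovkin_lambda \<infinity> T" "0 \<le> test_error x"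
proof -
  have T_test: "T f \<in> C_01" if "continuous_on {0..1} f" for f
    using T_in continuous_in[OF that] by auto
  note cont = T_test[unfolded C_01_def mem_Collect_eq]
  have "\<bar>T (\<lambda>_. 1) x - 1\<bar> \<le> Lp_norm \<infinity> (\<lambda>x. T (\<lambda>_. 1) x - 1)"
    "\<bar>T (\<lambda>t. t) x - x\<bar> \<le> Lp_norm \<infinity> (\<lambda>x. T (\<lambda>t. t) x - x)"
    "\<bar>T (\<lambda>t. - t) x + x\<bar> \<le> Lp_norm \<infinity> (\<lambda>x. T (\<lambda>t. - t) x + x)"
    "\<bar>T (\<lambda>t. t\<^sup>2) x - x\<^sup>2\<bar> \<le> Lp_norm \<infinity> (\<lambda>x. T (\<lambda>t. t\<^sup>2) x - x\<^sup>2)"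
    by (rule abs_le_Lp_norm_infinity[OF continuous_in assms]; intro continuous_intros cont)+
  moreover have "Lp_norm \<infinity> (\<lambda>x. T (\<lambda>_. 1) x - 1) \<le> korovkin_lambda \<infinity> T"
    "Lp_norm \<infinity> (\<lambda>x. T (\<lambda>t. t) x - x) \<le> korovkin_lambda \<infinity> T"
    "Lp_norm \<infinity> (\<lambda>x. T (\<lambda>t. - t) x + x) \<le> korovkin_lambda \<infinity> T"
    "Lp_norm \<infinity> (\<lambda>x. T (\<lambda>t. t\<^sup>2) x - x\<^sup>2) \<le> korovkin_lambda \<infinity> T"
    unfolding korovkin_lambda_def by (intro Max_ge; simp)+
  ultimately show "test_error x \<le> 4 * korovkin_lambda \<infinity> T" "0 \<le> test_error x"
    unfolding test_error_def by linarith+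
qed

text \<open>Splitting into \<open>f - g\<close>, \<open>g - T g\<close> and
  \<open>T g - T f\<close>, the outer terms cost \<open>W\<close> and \<open>L * W\<close>. The
  middle term is the smooth estimate, with 10 = 5 / 2 * 4.\<close>

lemma error_le_second_differences:
  assumes f: "f \<in> C_01" and e: "0 < \<epsilon>" "\<epsilon> \<le> 1 / 3" and x: "x \<in> {0..1}"
    and W: "\<And>h x. \<bar>h\<bar> \<le> \<epsilon> \<Longrightarrow> x \<in> {0..1} \<Longrightarrow> x + 2 * h \<in> {0..1} \<Longrightarrow>
              \<bar>f (x + 2 * h) - 2 * f (x + h) + f x\<bar> \<le> W"
  shows "\<bar>f x - T f x\<bar> \<le> (1 + L) * W
    + 10 * (2 * (Lp_norm \<infinity> f + W) + 9 * W / \<epsilon>\<^sup>2) * korovkin_lambda \<infinity> T"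
proof -
  \<comment> \<open>Clamping gives a function continuous on the whole line, as the antiderivatives
    require; the differences to be bounded involve only nodes inside the unit interval.\<close>
  define fc where "fc x = f (max 0 (min 1 x))" for x
  have fc: "fc x = f x" if "x \<in> {0..1}" for x
    using that by (simp add: fc_def)
  have "continuous_on UNIV fc"
    unfolding fc_def
  proof (rule continuous_on_compose2[of "{0..1}" f])
    show "continuous_on UNIV (\<lambda>x::real. max 0 (min 1 x))" by (intro continuous_intros)
  qed (use f in \<open>auto simp: C_01_def\<close>)
  moreover have "\<bar>fc (x + 2 * h) - 2 * fc (x + h) + fc x\<bar> \<le> W"
    if "\<bar>h\<bar> \<le> \<epsilon>" "x \<in> {0..1}" "x + 2 * h \<in> {0..1}" for h x
    using W[OF that] intermediate_node_in_unit[of x 2 h 1] that by (simp add: fc del: atLeastAtMost_iff)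
  ultimately obtain g g' g'' where g: "\<And>x. (g has_real_derivative g' x) (at x)"
    and g': "\<And>x. (g' has_real_derivative g'' x) (at x)"
    and gfc: "\<And>x. x \<in> {0..1} \<Longrightarrow> \<bar>g x - fc x\<bar> \<le> W"
    and g''_le: "\<And>x. x \<in> {0..1} \<Longrightarrow> \<bar>g'' x\<bar> \<le> 9 * W / \<epsilon>\<^sup>2"
    using e by (elim smoothing_second_order[of fc \<epsilon> W]) auto
  have gf: "\<bar>f x - g x\<bar> \<le> W" if "x \<in> {0..1}" for x
    using gfc[OF that] fc[OF that] by simp
  have g_in: "g \<in> C_01"
    by (rule continuous_in) (rule continuous_on_if_deriv[OF g])
  define M where "M = 9 * W / \<epsilon>\<^sup>2"
  define K where "K = 2 * (Lp_norm \<infinity> f + W) + M"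
  have M: "\<bar>g'' x\<bar> \<le> M" if "x \<in> {0..1}" for x
    using g''_le[OF that] by (simp add: M_def)
  have "0 \<le> M" using M[of 0] by simp
  have g_le: "\<bar>g x\<bar> \<le> Lp_norm \<infinity> f + W" if "x \<in> {0..1}" for x
    using gf[OF that] abs_le_Lp_norm_infinity[OF f that] by linarith
  \<comment> \<open>One value of \<open>g'\<close> is controlled by \<open>g\<close> alone, which
    explains the factor 2 in \<open>K\<close>; the bound on \<open>g''\<close> carries it to the
    whole interval.\<close>
  obtain \<xi> where \<xi>: "0 < \<xi>" "\<xi> < 1" "g 1 - g 0 = g' \<xi>"
    using MVT2[of 0 1 g g'] g by auto
  have g'_le: "\<bar>g' x\<bar> \<le> K" if x: "x \<in> {0..1}" for x
  proof -
    have "\<bar>g' x - g' \<xi>\<bar> \<le> M * \<bar>x - \<xi>\<bar>"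
      using field_differentiable_bound[of "{0..1}" g' g'' M x \<xi>] g' M x \<xi>
      by (auto intro: has_field_derivative_at_within)
    also have "\<dots> \<le> M * 1"
      using x \<xi> \<open>0 \<le> M\<close> by (intro mult_left_mono) auto
    finally show ?thesis
      using g_le[of 0] g_le[of 1] \<xi>(3) unfolding K_def by auto
  qed
  have gK: "\<bar>g x\<bar> \<le> K" "\<bar>g'' x\<bar> \<le> K" if "x \<in> {0..1}" for x
    using g_le[OF that] M[OF that] \<open>0 \<le> M\<close> unfolding K_def by auto
  have "\<bar>g x - T g x\<bar> \<le> 5 / 2 * K * test_error x"
    using smooth_estimate[OF g g' gK(1) g'_le gK(2)] x by (simp add: eventually_principal)
  also have "\<dots> \<le> 5 / 2 * K * (4 * korovkin_lambda \<infinity> T)"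
    using test_error_le[OF x] gK(1)[OF x] by (intro mult_left_mono) auto
  finally have "\<bar>g x - T g x\<bar> \<le> 10 * K * korovkin_lambda \<infinity> T" by simp
  moreover have "\<bar>T f x - T g x\<bar> \<le> T (\<lambda>_. W) x"
    using T_lipschitz[OF f g_in, of "\<lambda>_. W"] gf x continuous_in by (auto simp: eventually_principal)
  moreover have "T (\<lambda>_. W) x \<le> L * W"
    using gf g_in f x by (intro T_abs_le[of "\<lambda>x. f x - g x"] diff_in)
  ultimately show ?thesis
    using gf[OF x] unfolding K_def M_def by (simp add: algebra_simps)
qed

theorem error_estimate:
  assumes f: "f \<in> C_01"
  shows "Lp_norm \<infinity> (\<lambda>x. f x - T f x) \<le> 100 * (1 + L) *
    (Lp_norm \<infinity> f * korovkin_lambda \<infinity> T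
      + modulus_of_smoothness 2 \<infinity> f (korovkin_lambda \<infinity> T powr (1 / 2)))"
proof (rule Lp_norm_infinity_le)
  show "(\<lambda>x. f x - T f x) \<in> C_01"
    using f T_in by (intro diff_in) auto
  fix x :: real assume x: "x \<in> {0..1}"
  define lam N where "lam = korovkin_lambda \<infinity> T" and "N = Lp_norm \<infinity> f"
  define \<omega> where "\<omega> = modulus_of_smoothness 2 \<infinity> f (lam powr (1 / 2))"
  have lam: "0 \<le> lam" using test_error_le[OF x] by (simp add: lam_def)
  have N: "\<bar>f x\<bar> \<le> N" if "x \<in> {0..1}" for x
    using abs_le_Lp_norm_infinity[OF f that] by (simp add: N_def)
  have N0: "0 \<le> N" using N[OF x] by simp
  have \<omega>0: "0 \<le> \<omega>"
    using second_difference_le_modulus[OF f, of 0 "lam powr (1 / 2)" 0] by (simp add: \<omega>_def)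
  note L0 = op_norm_nonneg
  \<comment> \<open>The threshold is \<open>\<epsilon> = sqrt lam = 1 / 3\<close>.\<close>
  consider "1 / 9 \<le> lam" | "0 < lam" "lam < 1 / 9" | "lam = 0" using lam by linarith
  then have "\<bar>f x - T f x\<bar> \<le> 100 * (1 + L) * (N * lam + \<omega>)"
  proof cases
    case 1
    have "\<bar>f x - T f x\<bar> \<le> (1 + L) * N"
      using N[OF x] T_abs_le(2)[OF f N x] by (simp add: algebra_simps)
    also have "\<dots> \<le> (1 + L) * (N * (100 * lam))"
      using 1 L0 N0 by (intro mult_left_mono mult_left_le) (auto simp: mult_le_cancel_left1)
    also have "\<dots> = 100 * (1 + L) * (N * lam)" by simp
    also have "\<dots> \<le> 100 * (1 + L) * (N * lam + \<omega>)"
      using L0 \<omega>0 by (intro mult_left_mono) auto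
    finally show ?thesis .
  next
    case 2
    define \<epsilon> where "\<epsilon> = lam powr (1 / 2)"
    have \<epsilon>: "\<epsilon> = sqrt lam" using 2 by (simp add: \<epsilon>_def powr_half_sqrt)
    have "sqrt lam \<le> sqrt ((1 / 3)\<^sup>2)" using 2 by (intro real_sqrt_le_mono) (auto simp: power2_eq_square)
    then have e: "0 < \<epsilon>" "\<epsilon> \<le> 1 / 3" "\<epsilon>\<^sup>2 = lam" using 2 by (auto simp: \<epsilon>)
    have "\<bar>f (x + 2 * h) - 2 * f (x + h) + f x\<bar> \<le> \<omega>"
      if "\<bar>h\<bar> \<le> \<epsilon>" "x \<in> {0..1}" "x + 2 * h \<in> {0..1}" for h x
      unfolding \<omega>_def \<epsilon>_def[symmetric]
      by (rule second_difference_le_modulus[OF f _ _ that(2,3)]) (use that(1) e in auto)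
    from error_le_second_differences[OF f e(1,2) x this]
    have "\<bar>f x - T f x\<bar> \<le> (1 + L) * \<omega> + 10 * (2 * (N + \<omega>) + 9 * \<omega> / lam) * lam"
      unfolding e(3) by (simp add: N_def lam_def)
    \<comment> \<open>Since \<open>\<epsilon>\<^sup>2 = lam\<close>, the second derivative
      contributes 90 \<omega> free of \<open>lam\<close>; \<open>lam < 1 / 9\<close> keeps the
      remaining coefficient below the common constant.\<close>
    also have "\<dots> = (91 + L + 20 * lam) * \<omega> + 20 * (N * lam)"
      using 2 by (simp add: field_simps)
    also have "\<dots> \<le> (100 * (1 + L)) * \<omega> + (100 * (1 + L)) * (N * lam)"
      using 2 L0 N0 \<omega>0 by (intro add_mono mult_right_mono) auto
    finally show ?thesis by (simp add: algebra_simps)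
  next
    case 3
    \<comment> \<open>Any scale from uniform continuity works, however large
      \<open>1 / \<epsilon>\<^sup>2\<close> becomes, because the term containing it is multiplied by
      \<open>lam = 0\<close>.\<close>
    have "\<bar>f x - T f x\<bar> \<le> 0 + \<eta>" if \<eta>: "\<eta> > 0" for \<eta>
    proof -
      define \<eta>' where "\<eta>' = \<eta> / (2 * (1 + L))"
      have \<eta>': "\<eta>' > 0" using \<eta> L0 by (auto simp: \<eta>'_def)
      obtain \<epsilon> where e: "0 < \<epsilon>" "\<epsilon> \<le> 1 / 3"
        and unif: "\<And>x y. x \<in> {0..1} \<Longrightarrow> y \<in> {0..1} \<Longrightarrow> \<bar>x - y\<bar> \<le> \<epsilon> \<Longrightarrow> \<bar>f x - f y\<bar> \<le> \<eta>'"
        using f \<eta>' uniform_continuity_unit[of f \<eta>'] unfolding C_01_def by blast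
      have "\<bar>f (x + 2 * h) - 2 * f (x + h) + f x\<bar> \<le> 2 * \<eta>'"
        if "\<bar>h\<bar> \<le> \<epsilon>" "x \<in> {0..1}" "x + 2 * h \<in> {0..1}" for h x
      proof -
        have "x + h \<in> {0..1}" using intermediate_node_in_unit[of x 2 h 1] that by simp
        then have "\<bar>f (x + 2 * h) - f (x + h)\<bar> \<le> \<eta>'" "\<bar>f (x + h) - f x\<bar> \<le> \<eta>'"
          using that by (intro unif; simp)+
        then show ?thesis by linarith
      qed
      from error_le_second_differences[OF f e x this] 3
      have "\<bar>f x - T f x\<bar> \<le> (1 + L) * (2 * \<eta>')" by (simp add: lam_def)
      also have "\<dots> = \<eta>" using L0 by (simp add: \<eta>'_def field_simps)
      finally show ?thesis by simp
    qed
    then have "\<bar>f x - T f x\<bar> \<le> 0" by (rule field_le_epsilon)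
    also have "\<dots> \<le> 100 * (1 + L) * (N * lam + \<omega>)"
      using L0 N0 lam \<omega>0 by auto
    finally show ?thesis .
  qed
  then show "\<bar>f x - T f x\<bar> \<le> 100 * (1 + L) * (Lp_norm \<infinity> f * korovkin_lambda \<infinity> T
      + modulus_of_smoothness 2 \<infinity> f (korovkin_lambda \<infinity> T powr (1 / 2)))"
    by (simp add: N_def lam_def \<omega>_def)
qed

end

subsection \<open>The \<open>L\<^sub>1\<close> norm\<close>

lemma exists_value_le_mean:
  fixes g :: "real \<Rightarrow> real"
  assumes g: "continuous_on UNIV g" and ab: "0 \<le> a" "a < b" "b \<le> 1"
  obtains x where "a \<le> x" "x \<le> b" "\<bar>g x\<bar> * (b - a) \<le> integral {0..1} (\<lambda>x. \<bar>g x\<bar>)"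
proof -
  have cont: "continuous_on A (\<lambda>x. \<bar>g x\<bar>)" for A
    by (intro continuous_intros continuous_on_subset[OF g]) auto
  have "\<exists>x\<in>{a..b}. \<forall>y\<in>{a..b}. \<bar>g x\<bar> \<le> \<bar>g y\<bar>"
    using ab by (intro continuous_attains_inf cont) auto
  then obtain x where x: "x \<in> {a..b}" "\<And>y. y \<in> {a..b} \<Longrightarrow> \<bar>g x\<bar> \<le> \<bar>g y\<bar>" by blast
  have "\<bar>g x\<bar> * (b - a) = integral {a..b} (\<lambda>_. \<bar>g x\<bar>)"
    using ab by (simp add: mult.commute)
  also have "\<dots> \<le> integral {a..b} (\<lambda>x. \<bar>g x\<bar>)"
    using x by (intro integral_le integrable_continuous_real cont continuous_on_const)
  also have "\<dots> \<le> integral {0..1} (\<lambda>x. \<bar>g x\<bar>)"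
    using ab by (intro integral_subset_le integrable_continuous_real cont) auto
  finally show thesis using x(1) by (intro that[of x]) auto
qed

text \<open>The points to which this is applied are at least 1/7 apart, so each passage to a
  derivative costs the factor 14 = 2 * 7.\<close>

lemma mvt_abs_bound:
  fixes F f :: "real \<Rightarrow> real"
  assumes F: "\<And>x. (F has_real_derivative f x) (at x)" and ab: "1 / 7 \<le> b - a"
    and B: "\<bar>F a\<bar> \<le> B" "\<bar>F b\<bar> \<le> B"
  obtains \<xi> where "a < \<xi>" "\<xi> < b" "\<bar>f \<xi>\<bar> \<le> 14 * B"
proof -
  obtain \<xi> where \<xi>: "a < \<xi>" "\<xi> < b" "F b - F a = (b - a) * f \<xi>"
    using MVT2[of a b F f] F ab by auto
  have "1 / 7 * \<bar>f \<xi>\<bar> \<le> (b - a) * \<bar>f \<xi>\<bar>"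
    using ab by (intro mult_right_mono) auto
  also have "\<dots> = \<bar>F b - F a\<bar>"
    unfolding \<xi>(3) abs_mult using ab by simp
  also have "\<dots> \<le> 2 * B" using B by linarith
  finally show thesis using \<xi> by (intro that[of \<xi>]) auto
qed

text \<open>The mean values of \<open>g\<close> over four separated intervals control one value of \<open>g''\<close>.\<close>

lemma derivatives_bounded_by_integral:
  fixes g g' g'' :: "real \<Rightarrow> real"
  assumes g: "\<And>x. (g has_real_derivative g' x) (at x)"
    and g': "\<And>x. (g' has_real_derivative g'' x) (at x)"
    and V: "\<And>x y. x \<in> {0..1} \<Longrightarrow> y \<in> {0..1} \<Longrightarrow> \<bar>g'' x - g'' y\<bar> \<le> V"
    and x: "x \<in> {0..1}"
  defines "K \<equiv> 1477 * integral {0..1} (\<lambda>x. \<bar>g x\<bar>) + V"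
  shows "\<bar>g x\<bar> \<le> K" "\<bar>g' x\<bar> \<le> K" "\<bar>g'' x\<bar> \<le> K"
proof -
  define A where "A = integral {0..1} (\<lambda>x. \<bar>g x\<bar>)"
  note mean = exists_value_le_mean[OF continuous_on_if_deriv[OF g], folded A_def]
  obtain x0 where x0: "0 \<le> x0" "x0 \<le> 1 / 7" "\<bar>g x0\<bar> \<le> 7 * A"
    by (rule mean[of 0 "1 / 7"]) auto
  obtain x1 where x1: "2 / 7 \<le> x1" "x1 \<le> 3 / 7" "\<bar>g x1\<bar> \<le> 7 * A"
    by (rule mean[of "2 / 7" "3 / 7"]) auto
  obtain x2 where x2: "4 / 7 \<le> x2" "x2 \<le> 5 / 7" "\<bar>g x2\<bar> \<le> 7 * A"
    by (rule mean[of "4 / 7" "5 / 7"]) auto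
  obtain x3 where x3: "6 / 7 \<le> x3" "x3 \<le> 1" "\<bar>g x3\<bar> \<le> 7 * A"
    by (rule mean[of "6 / 7" 1]) auto
  have "1 / 7 \<le> x1 - x0" using x0 x1 by linarith
  then obtain \<xi>1 where \<xi>1: "x0 < \<xi>1" "\<xi>1 < x1" "\<bar>g' \<xi>1\<bar> \<le> 14 * (7 * A)"
    using mvt_abs_bound[OF g _ x0(3) x1(3)] by blast
  have "1 / 7 \<le> x3 - x2" using x2 x3 by linarith
  then obtain \<xi>2 where \<xi>2: "x2 < \<xi>2" "\<xi>2 < x3" "\<bar>g' \<xi>2\<bar> \<le> 14 * (7 * A)"
    using mvt_abs_bound[OF g _ x2(3) x3(3)] by blast
  have "1 / 7 \<le> \<xi>2 - \<xi>1" using x1 x2 \<xi>1 \<xi>2 by linarith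
  then obtain z where z: "\<xi>1 < z" "z < \<xi>2" "\<bar>g'' z\<bar> \<le> 14 * (14 * (7 * A))"
    using mvt_abs_bound[OF g' _ \<xi>1(3) \<xi>2(3)] by blast
  have A0: "0 \<le> A" using x0(3) by linarith
  have V0: "0 \<le> V" using V[OF x x] by simp
  have unit: "x0 \<in> {0..1}" "\<xi>1 \<in> {0..1}" "z \<in> {0..1}"
    using x0 x1 x2 x3 \<xi>1 \<xi>2 z by auto
  \<comment> \<open>The constants accumulate from the highest derivative down: 1372 = 14 * 14 * 7,
    then 1470 = 1372 + 14 * 7, then 1477 = 1470 + 7.\<close>
  have g''_le: "\<bar>g'' y\<bar> \<le> 1372 * A + V" if "y \<in> {0..1}" for y
    using V[OF that unit(3)] z(3) by linarith
  have g'_le: "\<bar>g' y\<bar> \<le> 1470 * A + V" if y: "y \<in> {0..1}" for y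
  proof -
    have "\<bar>g' y - g' \<xi>1\<bar> \<le> (1372 * A + V) * \<bar>y - \<xi>1\<bar>"
      using field_differentiable_bound[of "{0..1}" g' g'' "1372 * A + V" y \<xi>1] g' g''_le y unit
      by (auto intro: has_field_derivative_at_within)
    also have "\<dots> \<le> (1372 * A + V) * 1"
      using y unit A0 V0 by (intro mult_left_mono) auto
    finally have "\<bar>g' y - g' \<xi>1\<bar> \<le> 1372 * A + V" by simp
    moreover have "\<bar>g' y\<bar> \<le> \<bar>g' y - g' \<xi>1\<bar> + \<bar>g' \<xi>1\<bar>" by linarith
    ultimately show ?thesis using \<xi>1(3) by simp
  qed
  have "\<bar>g x - g x0\<bar> \<le> (1470 * A + V) * \<bar>x - x0\<bar>"
    using field_differentiable_bound[of "{0..1}" g g' "1470 * A + V" x x0] g g'_le x unit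
    by (auto intro: has_field_derivative_at_within)
  also have "\<dots> \<le> (1470 * A + V) * 1"
    using x unit A0 V0 by (intro mult_left_mono) auto
  finally have "\<bar>g x - g x0\<bar> \<le> 1470 * A + V" by simp
  moreover have "\<bar>g x\<bar> \<le> \<bar>g x - g x0\<bar> + \<bar>g x0\<bar>" by linarith
  ultimately show "\<bar>g x\<bar> \<le> K" using x0(3) unfolding K_def A_def[symmetric] by simp
  show "\<bar>g' x\<bar> \<le> K" "\<bar>g'' x\<bar> \<le> K"
    using g'_le[OF x] g''_le[OF x] A0 unfolding K_def A_def[symmetric] by linarith+
qed

section \<open>Third differences and continuous approximation in the mean\<close>

lemma integral_translate_le:
  fixes q :: "real \<Rightarrow> real"
  assumes q: "integrable (lebesgue_on {0..1}) q" and sub: "{a + c..b + c} \<subseteq> {0..1}"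
  shows "integrable (lebesgue_on {a..b}) (\<lambda>x. q (x + c))"
    and "(LINT x|lebesgue_on {a..b}. \<bar>q (x + c)\<bar>) \<le> (LINT x|lebesgue_on {0..1}. \<bar>q x\<bar>)"
proof -
  have int: "q integrable_on {0..1}" "(\<lambda>x. \<bar>q x\<bar>) integrable_on {0..1}"
    using q by (auto intro: integrable_on_lebesgue_on)
  note sub_int = int[THEN integrable_subinterval_real, OF sub]
  have shift: "(\<lambda>x. q (x + c)) integrable_on {a..b}" "(\<lambda>x. \<bar>q (x + c)\<bar>) integrable_on {a..b}"
    using sub_int[folded integrable_on_shift_Icc_real] by (simp_all add: o_def add.commute)
  then have "(\<lambda>x. q (x + c)) absolutely_integrable_on {a..b}"
    by (simp add: absolutely_integrable_on_def)
  then show *: "integrable (lebesgue_on {a..b}) (\<lambda>x. q (x + c))"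
    by (rule absolutely_integrable_imp_integrable) simp
  have "(LINT x|lebesgue_on {a..b}. \<bar>q (x + c)\<bar>) = integral {a..b} ((\<lambda>x. \<bar>q x\<bar>) \<circ> (+) c)"
    using * by (subst lebesgue_integral_eq_integral) (auto simp: o_def add.commute)
  also have "\<dots> = integral {a + c..b + c} (\<lambda>x. \<bar>q x\<bar>)"
    by (rule integral_shift_Icc_real)
  also have "\<dots> \<le> integral {0..1} (\<lambda>x. \<bar>q x\<bar>)"
    using sub int sub_int by (intro integral_subset_le) auto
  also have "\<dots> = (LINT x|lebesgue_on {0..1}. \<bar>q x\<bar>)"
    using q by (subst lebesgue_integral_eq_integral) auto
  finally show "(LINT x|lebesgue_on {a..b}. \<bar>q (x + c)\<bar>) \<le> (LINT x|lebesgue_on {0..1}. \<bar>q x\<bar>)" .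
qed

text \<open>Every node of the difference stays in the unit interval, so each translate has mean at
  most that of \<open>f\<close>; the coefficients add up to 8 = 1 + 3 + 3 + 1.\<close>

lemma third_difference_integrable:
  assumes f: "f \<in> L1_01"
  shows "integrable (lebesgue_on {x\<in>{0..1}. x + real 3 * h \<in> {0..1}}) (finite_diff 3 h f)"
    and "(LINT x|lebesgue_on {x\<in>{0..1}. x + real 3 * h \<in> {0..1}}. \<bar>finite_diff 3 h f x\<bar>)
      \<le> 8 * Lp_norm 1 f"
proof -
  define a b where "a = max 0 (- (real 3 * h))" and "b = min 1 (1 - real 3 * h)"
  have A: "{x\<in>{0..1}. x + real 3 * h \<in> {0..1}} = {a..b}"
    unfolding a_def b_def by (rule difference_domain_eq)
  have sub: "{a + t * h..b + t * h} \<subseteq> {0..1}" if t: "0 \<le> t" "t \<le> 3" for t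
  proof
    fix y assume "y \<in> {a + t * h..b + t * h}"
    then have "y - t * h \<in> {x\<in>{0..1}. x + real 3 * h \<in> {0..1}}"
      unfolding A by auto
    then show "y \<in> {0..1}"
      using intermediate_node_in_unit[of "y - t * h" 3 h t] t by simp
  qed
  have f': "integrable (lebesgue_on {0..1}) f" using f by (simp add: L1_01_def)
  note tr = integral_translate_le[OF f' sub]
  have int: "integrable (lebesgue_on {a..b}) (\<lambda>x. f (x + 3 * h))"
    "integrable (lebesgue_on {a..b}) (\<lambda>x. f (x + 2 * h))"
    "integrable (lebesgue_on {a..b}) (\<lambda>x. f (x + h))"
    "integrable (lebesgue_on {a..b}) (\<lambda>x. f x)"
    using tr(1)[of 3] tr(1)[of 2] tr(1)[of 1] tr(1)[of 0] by auto
  have le: "(LINT x|lebesgue_on {a..b}. \<bar>f (x + 3 * h)\<bar>) \<le> Lp_norm 1 f"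
    "(LINT x|lebesgue_on {a..b}. \<bar>f (x + 2 * h)\<bar>) \<le> Lp_norm 1 f"
    "(LINT x|lebesgue_on {a..b}. \<bar>f (x + h)\<bar>) \<le> Lp_norm 1 f"
    "(LINT x|lebesgue_on {a..b}. \<bar>f x\<bar>) \<le> Lp_norm 1 f"
    using tr(2)[of 3] tr(2)[of 2] tr(2)[of 1] tr(2)[of 0] by (auto simp: Lp_norm_on_1)
  show *: "integrable (lebesgue_on {x\<in>{0..1}. x + real 3 * h \<in> {0..1}}) (finite_diff 3 h f)"
    unfolding A finite_diff_3[abs_def]
    by (intro Bochner_Integration.integrable_add Bochner_Integration.integrable_diff integrable_mult_right int)
  have "(LINT x|lebesgue_on {a..b}. \<bar>finite_diff 3 h f x\<bar>) \<le> (LINT x|lebesgue_on {a..b}.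
      \<bar>f (x + 3 * h)\<bar> + 3 * \<bar>f (x + 2 * h)\<bar> + 3 * \<bar>f (x + h)\<bar> + \<bar>f x\<bar>)"
  proof (rule integral_mono)
    show "integrable (lebesgue_on {a..b}) (\<lambda>x. \<bar>finite_diff 3 h f x\<bar>)"
      using * by (simp only: A integrable_abs)
    show "\<bar>finite_diff 3 h f x\<bar> \<le> \<bar>f (x + 3 * h)\<bar> + 3 * \<bar>f (x + 2 * h)\<bar> + 3 * \<bar>f (x + h)\<bar> + \<bar>f x\<bar>" for x
      unfolding finite_diff_3 by (auto simp: abs_if)
  qed (intro Bochner_Integration.integrable_add integrable_mult_right integrable_abs int)
  also have "\<dots> = (LINT x|lebesgue_on {a..b}. \<bar>f (x + 3 * h)\<bar>) + 3 * (LINT x|lebesgue_on {a..b}. \<bar>f (x + 2 * h)\<bar>)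
      + 3 * (LINT x|lebesgue_on {a..b}. \<bar>f (x + h)\<bar>) + (LINT x|lebesgue_on {a..b}. \<bar>f x\<bar>)"
    using int by simp
  also have "\<dots> \<le> 8 * Lp_norm 1 f" using le by linarith
  finally show "(LINT x|lebesgue_on {x\<in>{0..1}. x + real 3 * h \<in> {0..1}}. \<bar>finite_diff 3 h f x\<bar>)
      \<le> 8 * Lp_norm 1 f"
    unfolding A .
qed

lemma third_difference_le_modulus:
  assumes f: "f \<in> L1_01" and h: "\<bar>h\<bar> \<le> \<delta>"
  shows "(LINT x|lebesgue_on {x\<in>{0..1}. x + real 3 * h \<in> {0..1}}. \<bar>finite_diff 3 h f x\<bar>)
    \<le> modulus_of_smoothness 3 1 f \<delta>"
  unfolding modulus_of_smoothness_def Lp_norm_on_1[symmetric]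
  using h third_difference_integrable(2)[OF f, folded Lp_norm_on_1]
  by (intro cSUP_upper bdd_aboveI2[where M = "8 * Lp_norm 1 f"]) auto

text \<open>Two dominated limits. Clipping \<open>f\<close> at height \<open>m\<close> leaves an
  error dominated by the absolute value of \<open>f\<close>. Measurability supplies continuous
  functions converging to \<open>f\<close> off a null set; clipping them at the same height
  preserves continuity and makes \<open>2 * m\<close> a dominating constant.\<close>

lemma L1_continuous_approximation:
  assumes f: "f \<in> L1_01" and \<eta>: "\<eta> > 0"
  obtains p where "continuous_on UNIV p" "Lp_norm 1 (\<lambda>x. f x - p x) \<le> \<eta>"
proof -
  let ?M = "lebesgue_on {0..1::real}"
  have f': "integrable ?M f"
    using f by (simp add: L1_01_def)
  note [measurable] = borel_measurable_integrable[OF f']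
  define c where "c m y = max (- real m) (min (real m) y)" for m and y :: real
  have "(\<lambda>m. LINT x|?M. \<bar>f x - c m (f x)\<bar>) \<longlonglongrightarrow> (LINT x|?M. 0)"
  proof (rule integral_dominated_convergence[where w = "\<lambda>x. \<bar>f x\<bar>"])
    show "AE x in ?M. (\<lambda>m. \<bar>f x - c m (f x)\<bar>) \<longlonglongrightarrow> 0"
    proof (rule AE_I2)
      fix x
      obtain n :: nat where n: "\<bar>f x\<bar> \<le> real n" using real_arch_simple by blast
      have "\<bar>f x - c m (f x)\<bar> = 0" if "n \<le> m" for m
      proof -
        have "\<bar>f x\<bar> \<le> real m" using n that by linarith
        then show ?thesis by (auto simp: c_def)
      qed
      then show "(\<lambda>m. \<bar>f x - c m (f x)\<bar>) \<longlonglongrightarrow> 0"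
        by (intro tendsto_eventually) (auto simp: eventually_sequentially)
    qed
    show "AE x in ?M. norm \<bar>f x - c m (f x)\<bar> \<le> \<bar>f x\<bar>" for m
      by (rule AE_I2) (auto simp: c_def)
    show "(\<lambda>x. \<bar>f x - c m (f x)\<bar>) \<in> borel_measurable ?M" for m
      unfolding c_def by measurable
  qed (use f' in auto)
  then have "\<forall>\<^sub>F m in sequentially. (LINT x|?M. \<bar>f x - c m (f x)\<bar>) < \<eta> / 2"
    using \<eta> by (intro order_tendstoD) auto
  then obtain m where m: "(LINT x|?M. \<bar>f x - c m (f x)\<bar>) < \<eta> / 2"
    using eventually_happens'[OF sequentially_bot] by blast
  have "f measurable_on {0..1}"
    by (simp add: measurable_on_iff_borel_measurable)
  then obtain Z g where Z: "negligible Z" and g: "\<And>n. continuous_on UNIV (g n)"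
    and lim: "\<And>x. x \<notin> Z \<Longrightarrow> (\<lambda>n. g n x) \<longlonglongrightarrow> (if x \<in> {0..1} then f x else 0)"
    unfolding measurable_on_def by blast
  have c_cont: "continuous_on UNIV (\<lambda>x. c m (g n x))" for n
    unfolding c_def by (intro continuous_intros g)
  then have c_meas[measurable]: "(\<lambda>x. c m (g n x)) \<in> borel_measurable ?M" for n
    by (intro continuous_imp_measurable_on_sets_lebesgue) (auto intro: continuous_on_subset)
  have cf_meas[measurable]: "(\<lambda>x. c m (f x)) \<in> borel_measurable ?M"
    unfolding c_def by measurable
  have "(\<lambda>n. LINT x|?M. \<bar>c m (f x) - c m (g n x)\<bar>) \<longlonglongrightarrow> (LINT x|?M. 0)"
  proof (rule integral_dominated_convergence[where w = "\<lambda>_. 2 * real m"])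
    have "AE x in lebesgue. x \<notin> Z"
      using Z by (intro AE_not_in) (simp add: negligible_iff_null_sets)
    then have "AE x in ?M. x \<notin> Z \<and> x \<in> {0..1}"
      by (subst AE_restrict_space_iff) (auto elim: eventually_mono)
    then show "AE x in ?M. (\<lambda>n. \<bar>c m (f x) - c m (g n x)\<bar>) \<longlonglongrightarrow> 0"
    proof eventually_elim
      case (elim x)
      then have "(\<lambda>n. g n x) \<longlonglongrightarrow> f x" using lim[of x] by simp
      then have "(\<lambda>n. \<bar>c m (f x) - c m (g n x)\<bar>) \<longlonglongrightarrow> \<bar>c m (f x) - c m (f x)\<bar>"
        unfolding c_def by (intro tendsto_intros)
      then show ?case by simp
    qed
    have c_le: "\<bar>c m y\<bar> \<le> real m" for y by (auto simp: c_def)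
    have "\<bar>c m y - c m z\<bar> \<le> 2 * real m" for y z
      using c_le[of y] c_le[of z] by linarith
    then show "AE x in ?M. norm \<bar>c m (f x) - c m (g n x)\<bar> \<le> 2 * real m" for n
      by (intro AE_I2) auto
  qed (auto intro!: continuous_imp_integrable_real)
  then have "\<forall>\<^sub>F n in sequentially. (LINT x|?M. \<bar>c m (f x) - c m (g n x)\<bar>) < \<eta> / 2"
    using \<eta> by (intro order_tendstoD) auto
  then obtain n where n: "(LINT x|?M. \<bar>c m (f x) - c m (g n x)\<bar>) < \<eta> / 2"
    using eventually_happens'[OF sequentially_bot] by blast
  have int_g: "integrable ?M (\<lambda>x. c m (g n x))"
    using c_cont by (intro continuous_imp_integrable_real) (auto intro: continuous_on_subset)
  have int_c: "integrable ?M (\<lambda>x. c m (f x))"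
    by (rule Bochner_Integration.integrable_bound[OF f']) (auto simp: c_def intro!: AE_I2)
  have "(LINT x|?M. \<bar>f x - c m (g n x)\<bar>) \<le>
      (LINT x|?M. \<bar>f x - c m (f x)\<bar> + \<bar>c m (f x) - c m (g n x)\<bar>)"
    by (intro integral_mono Bochner_Integration.integrable_add integrable_abs
        Bochner_Integration.integrable_diff f' int_g int_c) auto
  also have "\<dots> = (LINT x|?M. \<bar>f x - c m (f x)\<bar>) + (LINT x|?M. \<bar>c m (f x) - c m (g n x)\<bar>)"
    by (intro Bochner_Integration.integral_add integrable_abs
        Bochner_Integration.integrable_diff f' int_g int_c)
  also have "\<dots> \<le> \<eta>" using m n by linarith
  finally show thesis
    using c_cont by (intro that[of "\<lambda>x. c m (g n x)"]) (auto simp: Lp_norm_on_1)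
qed

section \<open>Operators on integrable functions\<close>

locale korovkin_operator_L1 =
  fixes T :: "(real \<Rightarrow> real) \<Rightarrow> real \<Rightarrow> real"
  assumes T_in: "T \<in> L1_01 \<rightarrow> L1_01" and sublinear: "sublinear_on L1_01 le_L1 T"
    and monotone: "monotone_on L1_01 le_L1 le_L1 T"
    and translatable: "strongly_translatable_on L1_01 le_L1 T"

sublocale korovkin_operator_L1 \<subseteq> korovkin_operator L1_01 "ae_filter (lebesgue_on {0..1})" T
proof
  fix f g :: "real \<Rightarrow> real" and \<alpha> c :: real and P :: "nat \<Rightarrow> real \<Rightarrow> bool"
  show "continuous_on {0..1} f \<Longrightarrow> f \<in> L1_01"
    by (simp add: L1_01_def continuous_imp_integrable_real)
  show "f \<in> L1_01 \<Longrightarrow> g \<in> L1_01 \<Longrightarrow> (\<lambda>x. f x + g x) \<in> L1_01"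
    "f \<in> L1_01 \<Longrightarrow> (\<lambda>x. c * f x) \<in> L1_01"
    by (simp_all add: L1_01_def)
  show "AE x in lebesgue_on {0..1}. x \<in> {0..1::real}"
    by (rule AE_I2) simp
  show "(\<And>i. AE x in lebesgue_on {0..1}. P i x) \<Longrightarrow> AE x in lebesgue_on {0..1}. \<forall>i. P i x"
    by (simp add: AE_all_countable)
  show "f \<in> L1_01 \<Longrightarrow> g \<in> L1_01 \<Longrightarrow> AE x in lebesgue_on {0..1}. T (\<lambda>x. f x + g x) x \<le> T f x + T g x"
    using sublinear by (simp add: sublinear_on_def le_L1_def)
  show "f \<in> L1_01 \<Longrightarrow> g \<in> L1_01 \<Longrightarrow> AE x in lebesgue_on {0..1}. f x \<le> g x \<Longrightarrow>
      AE x in lebesgue_on {0..1}. T f x \<le> T g x"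
    using monotone by (simp add: monotone_on_def le_L1_def)
  have eq: "AE x in lebesgue_on {0..1}. u x = v x" if "eq_by le_L1 u v" for u v :: "real \<Rightarrow> real"
    using that unfolding eq_by_def le_L1_def by (auto elim: eventually_elim2)
  show "f \<in> L1_01 \<Longrightarrow> 0 \<le> \<alpha> \<Longrightarrow> AE x in lebesgue_on {0..1}. T (\<lambda>x. \<alpha> * f x) x = \<alpha> * T f x"
    using sublinear by (intro eq) (simp add: sublinear_on_def)
  show "f \<in> L1_01 \<Longrightarrow> AE x in lebesgue_on {0..1}. T (\<lambda>x. f x + \<alpha>) x = T f x + \<alpha> * T (\<lambda>_. 1) x"
    using translatable by (intro eq) (simp add: strongly_translatable_on_def)
qed

lemma abs_in_L1: "f \<in> L1_01 \<Longrightarrow> (\<lambda>x. \<bar>f x\<bar>) \<in> L1_01"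
  by (simp add: L1_01_def)

lemma Lp_norm_1_nonneg: "0 \<le> Lp_norm 1 f"
  by (simp add: Lp_norm_on_1)

lemma Lp_norm_1_mono:
  assumes "f \<in> L1_01" "g \<in> L1_01" "AE x in lebesgue_on {0..1}. \<bar>f x\<bar> \<le> \<bar>g x\<bar>"
  shows "Lp_norm 1 f \<le> Lp_norm 1 g"
  unfolding Lp_norm_on_1 using assms by (intro integral_mono_AE) (auto simp: L1_01_def)

lemma Lp_norm_1_add:
  assumes "f \<in> L1_01" "g \<in> L1_01"
  shows "Lp_norm 1 (\<lambda>x. f x + g x) \<le> Lp_norm 1 f + Lp_norm 1 g"
proof -
  have "(LINT x|lebesgue_on {0..1}. \<bar>f x + g x\<bar>) \<le> (LINT x|lebesgue_on {0..1}. \<bar>f x\<bar> + \<bar>g x\<bar>)"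
    using assms by (intro integral_mono) (auto simp: L1_01_def)
  then show ?thesis
    using assms by (simp add: Lp_norm_on_1 L1_01_def)
qed

lemma Lp_norm_1_scale: "Lp_norm 1 (\<lambda>x. c * f x) = \<bar>c\<bar> * Lp_norm 1 f"
  by (simp add: Lp_norm_on_1 abs_mult)

lemma Lp_norm_1_cong_AE:
  assumes "f \<in> L1_01" "g \<in> L1_01" "AE x in lebesgue_on {0..1}. f x = g x"
  shows "Lp_norm 1 f = Lp_norm 1 g"
  using assms by (intro antisym Lp_norm_1_mono) (auto elim: eventually_mono)

lemma Lp_norm_1_continuous:
  "continuous_on {0..1} f \<Longrightarrow> Lp_norm 1 f = integral {0..1} (\<lambda>x. \<bar>f x\<bar>)"
  unfolding Lp_norm_on_1
  by (intro lebesgue_integral_eq_integral continuous_imp_integrable_real continuous_intros) auto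

context korovkin_operator_L1
begin

abbreviation "L \<equiv> op_norm 1 L1_01 T"

lemma T_in': "f \<in> L1_01 \<Longrightarrow> T f \<in> L1_01"
  using T_in by auto

text \<open>
  If \<open>\<parallel>T f\<^sub>n\<parallel> > n 2\<^sup>n\<close> with \<open>\<parallel>f\<^sub>n\<parallel> \<le> 1\<close>, then \<open>T\<close> applied to
  \<open>\<Sum>n. 2\<^sup>-\<^sup>n \<bar>f\<^sub>n\<bar>\<close> would dominate \<open>2\<^sup>-\<^sup>n \<bar>T f\<^sub>n\<bar>\<close> for every \<open>n\<close>.
\<close>

lemma T_bounded: "\<exists>B. \<forall>f\<in>L1_01. Lp_norm 1 f \<le> 1 \<longrightarrow> Lp_norm 1 (T f) \<le> B"
proof (rule ccontr)
  let ?M = "lebesgue_on {0..1::real}"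
  assume "\<not> ?thesis"
  then have "\<exists>f. f \<in> L1_01 \<and> Lp_norm 1 f \<le> 1 \<and> real n * 2 ^ n < Lp_norm 1 (T f)" for n
    by (meson not_le)
  then obtain f where f: "\<And>n. f n \<in> L1_01" "\<And>n. Lp_norm 1 (f n) \<le> 1"
    "\<And>n. real n * 2 ^ n < Lp_norm 1 (T (f n))"
    by metis
  define \<phi> where "\<phi> n x = (1 / 2) ^ n * \<bar>f n x\<bar>" for n x
  have \<phi>_nonneg: "0 \<le> \<phi> n x" for n x by (simp add: \<phi>_def)
  have \<phi>_in: "\<phi> n \<in> L1_01" for n
    unfolding \<phi>_def using scale_in[OF abs_in_L1[OF f(1)]] .
  then have \<phi>_int: "integrable ?M (\<phi> n)" for n
    by (simp add: L1_01_def)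
  have int_le: "(LINT x|?M. \<phi> n x) \<le> (1 / 2) ^ n" for n
    using f(2)[of n] by (simp add: \<phi>_def Lp_norm_on_1 divide_right_mono power_one_over)
  have int_nonneg: "0 \<le> (LINT x|?M. \<phi> n x)" for n
    by (intro Bochner_Integration.integral_nonneg \<phi>_nonneg)
  have summable_int: "summable (\<lambda>n. LINT x|?M. \<phi> n x)"
    by (rule summable_comparison_test'[of "\<lambda>n. (1 / 2) ^ n"])
       (use int_le int_nonneg in \<open>auto intro: summable_geometric\<close>)
  have "(\<integral>\<^sup>+x. (\<Sum>n. ennreal (\<phi> n x)) \<partial>?M) = (\<Sum>n. \<integral>\<^sup>+x. ennreal (\<phi> n x) \<partial>?M)"
    using \<phi>_int by (intro nn_integral_suminf) auto
  also have "\<dots> = (\<Sum>n. ennreal (LINT x|?M. \<phi> n x))"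
    using \<phi>_int \<phi>_nonneg by (simp add: nn_integral_eq_integral)
  also have "\<dots> = ennreal (\<Sum>n. LINT x|?M. \<phi> n x)"
    using int_nonneg summable_int by (rule suminf_ennreal2)
  finally have "AE x in ?M. (\<Sum>n. ennreal (\<phi> n x)) \<noteq> \<infinity>"
    using \<phi>_int by (intro nn_integral_PInf_AE) auto
  then have summable_\<phi>: "AE x in ?M. summable (\<lambda>n. \<phi> n x)"
    by eventually_elim (simp add: summable_suminf_not_top \<phi>_nonneg)
  \<comment> \<open>Where the series diverges this value is arbitrary, but that happens only on a
    null set.\<close>
  define S where "S x = (\<Sum>n. \<phi> n x)" for x
  have S: "S \<in> L1_01"
    unfolding S_def L1_01_def mem_Collect_eq
    using \<phi>_int summable_\<phi> summable_int \<phi>_nonneg by (intro integrable_suminf) auto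
  have bound: "(1 / 2) ^ n * Lp_norm 1 (T (f n)) \<le> Lp_norm 1 (T S)" for n
  proof -
    have abs_in: "(\<lambda>x. \<bar>f n x\<bar>) \<in> L1_01" by (rule abs_in_L1[OF f(1)])
    have "AE x in ?M. \<bar>T (f n) x\<bar> \<le> T (\<lambda>x. \<bar>f n x\<bar>) x"
      using f(1) abs_in by (rule T_dominated) simp
    moreover have "AE x in ?M. T (\<phi> n) x = (1 / 2) ^ n * T (\<lambda>x. \<bar>f n x\<bar>) x"
      unfolding \<phi>_def using abs_in by (rule T_scale) simp
    moreover have "AE x in ?M. T (\<phi> n) x \<le> T S x"
    proof (rule T_mono[OF \<phi>_in S])
      show "AE x in ?M. \<phi> n x \<le> S x"
        using summable_\<phi>
      proof eventually_elim
        case (elim x)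
        have "(\<Sum>k\<in>{n}. \<phi> k x) \<le> S x"
          unfolding S_def using elim \<phi>_nonneg by (intro sum_le_suminf) auto
        then show ?case by simp
      qed
    qed
    ultimately have "AE x in ?M. \<bar>(1 / 2) ^ n * T (f n) x\<bar> \<le> \<bar>T S x\<bar>"
    proof eventually_elim
      case (elim x)
      have "\<bar>(1 / 2) ^ n * T (f n) x\<bar> \<le> (1 / 2) ^ n * T (\<lambda>x. \<bar>f n x\<bar>) x"
        unfolding abs_mult using elim(1) by (simp add: mult_left_mono)
      then show ?case using elim(2,3) by linarith
    qed
    then have "Lp_norm 1 (\<lambda>x. (1 / 2) ^ n * T (f n) x) \<le> Lp_norm 1 (T S)"
      by (intro Lp_norm_1_mono scale_in T_in' f S)
    then show ?thesis
      unfolding Lp_norm_1_scale by simp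
  qed
  obtain n where n: "Lp_norm 1 (T S) < real n" using reals_Archimedean2 by blast
  have "real n = (1 / 2) ^ n * (real n * 2 ^ n)"
    by (simp add: power_one_over)
  also have "\<dots> \<le> (1 / 2) ^ n * Lp_norm 1 (T (f n))"
    using f(3)[of n] by (intro mult_left_mono) auto
  also note bound
  finally show False using n by simp
qed

text \<open>Finiteness of the supremum allows normalisation and homogeneity. A function of norm 0
  cannot be normalised; it is dominated by 0 almost everywhere, hence so is its image.\<close>

lemma op_norm_bound:
  assumes f: "f \<in> L1_01"
  shows "Lp_norm 1 (T f) \<le> L * Lp_norm 1 f" "0 \<le> L"
proof -
  obtain B where B: "\<And>f. f \<in> L1_01 \<Longrightarrow> Lp_norm 1 f \<le> 1 \<Longrightarrow> Lp_norm 1 (T f) \<le> B"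
    using T_bounded by blast
  have le: "Lp_norm 1 (T g) \<le> L" if "g \<in> L1_01" "Lp_norm 1 g \<le> 1" for g
    unfolding op_norm_def using that B by (intro cSUP_upper bdd_aboveI2[where M = B]) auto
  have zero: "(\<lambda>_. 0) \<in> L1_01" by (rule continuous_in) simp
  have "Lp_norm 1 (\<lambda>_. 0) \<le> 1" by (simp add: Lp_norm_on_1)
  from le[OF zero this] show "0 \<le> L"
    using Lp_norm_1_nonneg[of "T (\<lambda>_. 0)"] by linarith
  define N where "N = Lp_norm 1 f"
  show "Lp_norm 1 (T f) \<le> L * Lp_norm 1 f"
  proof (cases "N = 0")
    case True
    have "AE x in lebesgue_on {0..1}. \<bar>f x\<bar> = 0"
      using f True unfolding N_def Lp_norm_on_1
      by (subst (asm) integral_nonneg_eq_0_iff_AE) (auto simp: L1_01_def)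
    then have "AE x in lebesgue_on {0..1}. \<bar>T f x\<bar> \<le> T (\<lambda>_. 0) x"
      by (intro T_dominated f zero) auto
    with T_zero have "AE x in lebesgue_on {0..1}. T f x = 0"
      by eventually_elim auto
    then have "Lp_norm 1 (T f) = Lp_norm 1 (\<lambda>_. 0)"
      by (intro Lp_norm_1_cong_AE T_in' f zero)
    then show ?thesis using True by (simp add: N_def Lp_norm_on_1)
  next
    case False
    then have N: "0 < N" using Lp_norm_1_nonneg[of f] by (simp add: N_def)
    define g where "g x = 1 / N * f x" for x
    have g: "g \<in> L1_01" unfolding g_def by (rule scale_in[OF f])
    have "Lp_norm 1 g = 1"
      unfolding g_def Lp_norm_1_scale using N by (simp add: N_def)
    then have "Lp_norm 1 (T g) \<le> L" using le[OF g] by simp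
    moreover have "Lp_norm 1 (T g) = Lp_norm 1 (\<lambda>x. 1 / N * T f x)"
      unfolding g_def using N by (intro Lp_norm_1_cong_AE T_in' scale_in f T_scale) auto
    ultimately have "1 / N * Lp_norm 1 (T f) \<le> L"
      unfolding Lp_norm_1_scale using N by simp
    then show ?thesis using N by (simp add: N_def field_simps)
  qed
qed

lemma T_lipschitz_norm:
  assumes f: "f \<in> L1_01" and g: "g \<in> L1_01"
  shows "Lp_norm 1 (\<lambda>x. T g x - T f x) \<le> L * Lp_norm 1 (\<lambda>x. f x - g x)"
proof -
  define d where "d x = \<bar>f x - g x\<bar>" for x
  have d: "d \<in> L1_01" unfolding d_def by (intro abs_in_L1 diff_in f g)
  have "AE x in lebesgue_on {0..1}. \<bar>T g x - T f x\<bar> \<le> T d x"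
    by (intro T_lipschitz f g d) (simp add: d_def abs_minus_commute)
  then have "Lp_norm 1 (\<lambda>x. T g x - T f x) \<le> Lp_norm 1 (T d)"
    by (intro Lp_norm_1_mono diff_in T_in' f g d) (auto elim: eventually_mono)
  also have "\<dots> \<le> L * Lp_norm 1 d" by (rule op_norm_bound[OF d])
  also have "Lp_norm 1 d = Lp_norm 1 (\<lambda>x. f x - g x)" by (simp add: Lp_norm_on_1 d_def)
  finally show ?thesis .
qed

lemma test_error_norm:
  shows "test_error \<in> L1_01" "Lp_norm 1 test_error \<le> 4 * korovkin_lambda 1 T"
    "0 \<le> korovkin_lambda 1 T"
proof -
  have test: "(\<lambda>x. T f x - h x) \<in> L1_01" if "continuous_on {0..1} f" "continuous_on {0..1} h" for f h
    by (intro diff_in T_in' continuous_in that)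
  have "(\<lambda>x. T (\<lambda>t. - t) x - (- x)) \<in> L1_01"
    by (intro test continuous_intros)
  then have e: "(\<lambda>x. T (\<lambda>_. 1) x - 1) \<in> L1_01" "(\<lambda>x. T (\<lambda>t. t) x - x) \<in> L1_01"
    "(\<lambda>x. T (\<lambda>t. - t) x + x) \<in> L1_01" "(\<lambda>x. T (\<lambda>t. t\<^sup>2) x - x\<^sup>2) \<in> L1_01"
    by (auto intro!: test continuous_intros)
  note int = e[THEN abs_in_L1, unfolded L1_01_def mem_Collect_eq]
  show "test_error \<in> L1_01"
    unfolding test_error_def[abs_def] by (intro add_in abs_in_L1 e)
  have "Lp_norm 1 test_error = (LINT x|lebesgue_on {0..1}. test_error x)"
    unfolding Lp_norm_on_1 by (intro Bochner_Integration.integral_cong) (auto simp: test_error_def)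
  also have "\<dots> = Lp_norm 1 (\<lambda>x. T (\<lambda>_. 1) x - 1) + Lp_norm 1 (\<lambda>x. T (\<lambda>t. t) x - x)
      + Lp_norm 1 (\<lambda>x. T (\<lambda>t. - t) x + x) + Lp_norm 1 (\<lambda>x. T (\<lambda>t. t\<^sup>2) x - x\<^sup>2)"
    unfolding test_error_def Lp_norm_on_1 using int by simp
  also have "\<dots> \<le> 4 * korovkin_lambda 1 T"
  proof -
    have "Lp_norm 1 (\<lambda>x. T (\<lambda>_. 1) x - 1) \<le> korovkin_lambda 1 T"
      "Lp_norm 1 (\<lambda>x. T (\<lambda>t. t) x - x) \<le> korovkin_lambda 1 T"
      "Lp_norm 1 (\<lambda>x. T (\<lambda>t. - t) x + x) \<le> korovkin_lambda 1 T"
      "Lp_norm 1 (\<lambda>x. T (\<lambda>t. t\<^sup>2) x - x\<^sup>2) \<le> korovkin_lambda 1 T"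
      unfolding korovkin_lambda_def by (intro Max_ge; simp)+
    then show ?thesis by linarith
  qed
  finally show "Lp_norm 1 test_error \<le> 4 * korovkin_lambda 1 T" .
  then show "0 \<le> korovkin_lambda 1 T"
    using Lp_norm_1_nonneg[of test_error] by linarith
qed

text \<open>The distance from \<open>f\<close> to \<open>g\<close>, through \<open>p\<close>, is at
  most \<open>\<eta> + 6 * W\<close>. It enters twice: in the outer terms of the splitting with
  factor \<open>1 + L\<close>, and in the norm of \<open>g\<close> that bounds its
  derivatives.\<close>

lemma error_le_third_differences:
  assumes f: "f \<in> L1_01" and p: "continuous_on UNIV p" and fp: "Lp_norm 1 (\<lambda>x. f x - p x) \<le> \<eta>"
    and e: "0 < \<epsilon>" "\<epsilon> \<le> 1 / 3"
    and W: "\<And>h. \<bar>h\<bar> \<le> \<epsilon> \<Longrightarrow> integral {x \<in> {0..1}. x + 3 * h \<in> {0..1}}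
              (\<lambda>x. \<bar>p (x + 3 * h) - 3 * p (x + 2 * h) + 3 * p (x + h) - p x\<bar>) \<le> W"
  shows "Lp_norm 1 (\<lambda>x. f x - T f x) \<le> (1 + L) * (\<eta> + 6 * W)
    + 10 * (1477 * (Lp_norm 1 f + \<eta> + 6 * W) + 93 * W / \<epsilon> ^ 3) * korovkin_lambda 1 T"
proof -
  obtain g g' g'' where g: "\<And>x. (g has_real_derivative g' x) (at x)"
    and g': "\<And>x. (g' has_real_derivative g'' x) (at x)"
    and gp: "integral {0..1} (\<lambda>x. \<bar>g x - p x\<bar>) \<le> 6 * W"
    and osc: "\<And>x y. x \<in> {0..1} \<Longrightarrow> y \<in> {0..1} \<Longrightarrow> \<bar>g'' x - g'' y\<bar> \<le> 93 * W / \<epsilon> ^ 3"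
    using smoothing_third_order[OF p e W] by blast
  define K where "K = 1477 * integral {0..1} (\<lambda>x. \<bar>g x\<bar>) + 93 * W / \<epsilon> ^ 3"
  have K: "\<bar>g x\<bar> \<le> K" "\<bar>g' x\<bar> \<le> K" "\<bar>g'' x\<bar> \<le> K" if "x \<in> {0..1}" for x
    using derivatives_bounded_by_integral[OF g g' osc that] unfolding K_def by blast+
  have K0: "0 \<le> K" using K(1)[of 0] by simp
  have p_cont: "continuous_on {0..1} p" by (rule continuous_on_subset[OF p]) simp
  have g_cont: "continuous_on {0..1} g" by (rule continuous_on_if_deriv[OF g])
  note in_L1 = f continuous_in[OF p_cont] continuous_in[OF g_cont]
  have "Lp_norm 1 (\<lambda>x. p x - g x) = integral {0..1} (\<lambda>x. \<bar>g x - p x\<bar>)"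
    using p_cont g_cont by (subst Lp_norm_1_continuous)
      (auto simp: abs_minus_commute intro!: continuous_intros)
  with gp have pg: "Lp_norm 1 (\<lambda>x. p x - g x) \<le> 6 * W" by simp
  have "Lp_norm 1 (\<lambda>x. (f x - p x) + (p x - g x)) \<le> Lp_norm 1 (\<lambda>x. f x - p x) + Lp_norm 1 (\<lambda>x. p x - g x)"
    by (intro Lp_norm_1_add diff_in in_L1)
  then have fg: "Lp_norm 1 (\<lambda>x. f x - g x) \<le> \<eta> + 6 * W"
    using fp pg by simp
  have "Lp_norm 1 (\<lambda>x. f x + (-1) * (f x - g x)) \<le> Lp_norm 1 f + Lp_norm 1 (\<lambda>x. (-1) * (f x - g x))"
    by (intro Lp_norm_1_add scale_in diff_in in_L1)
  then have "Lp_norm 1 g \<le> Lp_norm 1 f + (\<eta> + 6 * W)"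
    using fg unfolding Lp_norm_1_scale by simp
  then have K_le: "K \<le> 1477 * (Lp_norm 1 f + \<eta> + 6 * W) + 93 * W / \<epsilon> ^ 3"
    unfolding K_def Lp_norm_1_continuous[OF g_cont, symmetric] by simp
  have "AE x in lebesgue_on {0..1}. \<bar>g x - T g x\<bar> \<le> 5 / 2 * K * test_error x"
    by (rule smooth_estimate[OF g g' K])
  then have "Lp_norm 1 (\<lambda>x. g x - T g x) \<le> Lp_norm 1 (\<lambda>x. 5 / 2 * K * test_error x)"
    by (intro Lp_norm_1_mono diff_in scale_in T_in' in_L1 test_error_norm) (auto elim: eventually_mono)
  also have "\<dots> = 5 / 2 * K * Lp_norm 1 test_error"
    unfolding Lp_norm_1_scale using K0 by simp
  also have "\<dots> \<le> 5 / 2 * K * (4 * korovkin_lambda 1 T)"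
    using K0 by (intro mult_left_mono test_error_norm) auto
  also have "\<dots> = 10 * K * korovkin_lambda 1 T" by simp
  also have "\<dots> \<le> 10 * (1477 * (Lp_norm 1 f + \<eta> + 6 * W) + 93 * W / \<epsilon> ^ 3) * korovkin_lambda 1 T"
    using K_le test_error_norm(3) by (intro mult_right_mono mult_left_mono) auto
  finally have gTg: "Lp_norm 1 (\<lambda>x. g x - T g x)
      \<le> 10 * (1477 * (Lp_norm 1 f + \<eta> + 6 * W) + 93 * W / \<epsilon> ^ 3) * korovkin_lambda 1 T" .
  have "L * Lp_norm 1 (\<lambda>x. f x - g x) \<le> L * (\<eta> + 6 * W)"
    using fg op_norm_bound(2)[OF f] by (intro mult_left_mono)
  then have TgTf: "Lp_norm 1 (\<lambda>x. T g x - T f x) \<le> L * (\<eta> + 6 * W)"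
    using T_lipschitz_norm[OF in_L1(1,3)] by linarith
  have "Lp_norm 1 (\<lambda>x. (f x - g x) + ((g x - T g x) + (T g x - T f x)))
      \<le> Lp_norm 1 (\<lambda>x. f x - g x) + (Lp_norm 1 (\<lambda>x. g x - T g x) + Lp_norm 1 (\<lambda>x. T g x - T f x))"
    by (intro order_trans[OF Lp_norm_1_add] add_left_mono Lp_norm_1_add add_in diff_in T_in' in_L1)
  then show ?thesis
    using fg gTg TgTf by (simp add: algebra_simps)
qed

text \<open>Third differences of \<open>p\<close> and \<open>f\<close> differ by those of
  \<open>f - p\<close>, whose means are at most \<open>8 * \<eta>\<close>; this yields
  \<open>W = \<omega> + 8 * \<eta>\<close>. The threshold 1 / 27 corresponds to \<epsilon> = 1 /
  3.\<close>

lemma error_estimate_approx: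
  assumes f: "f \<in> L1_01" and \<eta>: "0 < \<eta>"
    and lam: "0 < korovkin_lambda 1 T" "korovkin_lambda 1 T \<le> 1 / 27"
  defines "\<omega> \<equiv> modulus_of_smoothness 3 1 f (korovkin_lambda 1 T powr (1 / 3))"
  shows "Lp_norm 1 (\<lambda>x. f x - T f x) \<le> (1 + L) * (\<eta> + 6 * (\<omega> + 8 * \<eta>))
    + 10 * (1477 * (Lp_norm 1 f + \<eta> + 6 * (\<omega> + 8 * \<eta>)) * korovkin_lambda 1 T + 93 * (\<omega> + 8 * \<eta>))"
proof -
  define \<epsilon> where "\<epsilon> = korovkin_lambda 1 T powr (1 / 3)"
  have cube: "\<epsilon> ^ 3 = korovkin_lambda 1 T"
    using lam by (simp add: \<epsilon>_def powr_power)
  have e0: "0 < \<epsilon>" using lam by (simp add: \<epsilon>_def)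
  have "\<epsilon> ^ 3 \<le> (1 / 3) ^ 3" unfolding cube using lam by (simp add: power3_eq_cube)
  then have e1: "\<epsilon> \<le> 1 / 3"
    using e0 by (subst (asm) power_mono_iff) auto
  obtain p where p: "continuous_on UNIV p" and fp: "Lp_norm 1 (\<lambda>x. f x - p x) \<le> \<eta>"
    using L1_continuous_approximation[OF f \<eta>] .
  have p_in: "p \<in> L1_01"
    by (rule continuous_in) (rule continuous_on_subset[OF p], simp)
  have "integral {x \<in> {0..1}. x + 3 * h \<in> {0..1}}
      (\<lambda>x. \<bar>p (x + 3 * h) - 3 * p (x + 2 * h) + 3 * p (x + h) - p x\<bar>) \<le> \<omega> + 8 * \<eta>"
    if h: "\<bar>h\<bar> \<le> \<epsilon>" for h
  proof -
    let ?A = "{x\<in>{0..1}. x + real 3 * h \<in> {0..1}}"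
    define q where "q x = f x - p x" for x
    have q_in: "q \<in> L1_01" unfolding q_def by (intro diff_in f p_in)
    have A: "?A \<in> sets lebesgue" unfolding difference_domain_eq by simp
    note int = third_difference_integrable(1)[of _ h]
    have diff: "finite_diff 3 h p x = finite_diff 3 h f x - finite_diff 3 h q x" for x
      by (simp add: finite_diff_3 q_def)
    have "integral ?A (\<lambda>x. \<bar>finite_diff 3 h p x\<bar>) = (LINT x|lebesgue_on ?A. \<bar>finite_diff 3 h p x\<bar>)"
      using int[OF p_in] A by (intro lebesgue_integral_eq_integral[symmetric] integrable_abs)
    also have "\<dots> \<le> (LINT x|lebesgue_on ?A. \<bar>finite_diff 3 h f x\<bar> + \<bar>finite_diff 3 h q x\<bar>)"
    proof (rule integral_mono)
      show "\<bar>finite_diff 3 h p x\<bar> \<le> \<bar>finite_diff 3 h f x\<bar> + \<bar>finite_diff 3 h q x\<bar>" for x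
        unfolding diff by linarith
    qed (intro Bochner_Integration.integrable_add integrable_abs int f p_in q_in)+
    also have "\<dots> = (LINT x|lebesgue_on ?A. \<bar>finite_diff 3 h f x\<bar>)
        + (LINT x|lebesgue_on ?A. \<bar>finite_diff 3 h q x\<bar>)"
      by (intro Bochner_Integration.integral_add integrable_abs int f q_in)
    also have "\<dots> \<le> \<omega> + 8 * Lp_norm 1 q"
      unfolding \<omega>_def \<epsilon>_def[symmetric]
      by (intro add_mono third_difference_le_modulus[OF f h] third_difference_integrable(2)[OF q_in])
    also have "\<dots> \<le> \<omega> + 8 * \<eta>" using fp by (simp add: q_def[abs_def])
    finally show ?thesis by (simp add: finite_diff_3)
  qed
  note estimate = error_le_third_differences[OF f p fp e0 e1 this, unfolded cube]
  have "10 * (X + 93 * Y / l) * l = 10 * (X * l + 93 * Y)" if "0 < l" for X Y l :: real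
    using that by (simp add: field_simps)
  from estimate[unfolded this[OF lam(1)]] show ?thesis .
qed

lemma error_zero:
  assumes f: "f \<in> L1_01" and lam: "korovkin_lambda 1 T = 0"
  shows "Lp_norm 1 (\<lambda>x. f x - T f x) \<le> 0"
proof -
  note L0 = op_norm_bound(2)[OF f]
  have "Lp_norm 1 (\<lambda>x. f x - T f x) \<le> 0 + \<delta>" if \<delta>: "\<delta> > 0" for \<delta>
  proof -
    \<comment> \<open>25 = 1 + 6 * 4: the approximation error and six times the bound
      \<open>4 * \<eta>\<close> on third differences.\<close>
    define \<eta> where "\<eta> = \<delta> / (25 * (1 + L))"
    have \<eta>: "\<eta> > 0" using \<delta> L0 by (auto simp: \<eta>_def)
    obtain p where p: "continuous_on UNIV p" and fp: "Lp_norm 1 (\<lambda>x. f x - p x) \<le> \<eta>"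
      using L1_continuous_approximation[OF f \<eta>] .
    have "continuous_on {0..1} p" by (rule continuous_on_subset[OF p]) simp
    then obtain \<epsilon> where e: "0 < \<epsilon>" "\<epsilon> \<le> 1 / 3"
      and unif: "\<And>x y. x \<in> {0..1} \<Longrightarrow> y \<in> {0..1} \<Longrightarrow> \<bar>x - y\<bar> \<le> \<epsilon> \<Longrightarrow> \<bar>p x - p y\<bar> \<le> \<eta>"
      using uniform_continuity_unit[OF _ \<eta>, of p] by blast
    have "integral {x \<in> {0..1}. x + 3 * h \<in> {0..1}}
        (\<lambda>x. \<bar>p (x + 3 * h) - 3 * p (x + 2 * h) + 3 * p (x + h) - p x\<bar>) \<le> 4 * \<eta>"
      if h: "\<bar>h\<bar> \<le> \<epsilon>" for h
    proof -
      define D where "D x = \<bar>p (x + 3 * h) - 3 * p (x + 2 * h) + 3 * p (x + h) - p x\<bar>" for x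
      define a b where "a = max 0 (- (real 3 * h))" and "b = min 1 (1 - real 3 * h)"
      have A: "{x\<in>{0..1}. x + 3 * h \<in> {0..1}} = {a..b}"
        unfolding a_def b_def using difference_domain_eq[of 3 h] by simp
      have "a \<le> b" "b - a \<le> 1" using h e by (auto simp: a_def b_def)
      have "D x \<le> 4 * \<eta>" if "x \<in> {a..b}" for x
      proof -
        have x: "x \<in> {0..1}" "x + 3 * h \<in> {0..1}" using that unfolding A[symmetric] by auto
        then have nodes: "x + 2 * h \<in> {0..1}" "x + h \<in> {0..1}"
          using intermediate_node_in_unit[of x 3 h 2] intermediate_node_in_unit[of x 3 h 1] by auto
        \<comment> \<open>The third difference combines these first differences with coefficients 1,
          -2, 1, whence \<open>4 * \<eta>\<close>.\<close>
        have "\<bar>p (x + 3 * h) - p (x + 2 * h)\<bar> \<le> \<eta>" "\<bar>p (x + 2 * h) - p (x + h)\<bar> \<le> \<eta>"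
          "\<bar>p (x + h) - p x\<bar> \<le> \<eta>"
          using x nodes h by (intro unif; simp)+
        then show ?thesis unfolding D_def by linarith
      qed
      moreover have "D integrable_on {a..b}"
        unfolding D_def
        by (intro integrable_continuous_real continuous_intros continuous_on_compose2[OF p]) auto
      ultimately have "integral {a..b} D \<le> integral {a..b} (\<lambda>_. 4 * \<eta>)"
        by (intro integral_le) auto
      also have "\<dots> \<le> 4 * \<eta>"
        using \<open>a \<le> b\<close> \<open>b - a \<le> 1\<close> \<eta> by simp
      finally show ?thesis unfolding A D_def .
    qed
    from error_le_third_differences[OF f p fp e this]
    have "Lp_norm 1 (\<lambda>x. f x - T f x) \<le> (1 + L) * (\<eta> + 6 * (4 * \<eta>))"
      by (simp add: lam)
    also have "\<dots> = 25 * (1 + L) * \<eta>" by (simp add: algebra_simps)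
    also have "\<dots> = \<delta>" using L0 by (simp add: \<eta>_def)
    finally show ?thesis by simp
  qed
  then show ?thesis by (rule field_le_epsilon)
qed

theorem error_estimate:
  assumes f: "f \<in> L1_01"
  shows "Lp_norm 1 (\<lambda>x. f x - T f x) \<le> 20000 * (1 + L) *
    (Lp_norm 1 f * korovkin_lambda 1 T
      + modulus_of_smoothness 3 1 f (korovkin_lambda 1 T powr (1 / 3)))"
proof -
  define lam N where "lam = korovkin_lambda 1 T" and "N = Lp_norm 1 f"
  define \<omega> where "\<omega> = modulus_of_smoothness 3 1 f (lam powr (1 / 3))"
  define R where "R = Lp_norm 1 (\<lambda>x. f x - T f x)"
  note L0 = op_norm_bound(2)[OF f]
  have lam0: "0 \<le> lam" using test_error_norm(3) by (simp add: lam_def)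
  have N0: "0 \<le> N" by (simp add: N_def Lp_norm_1_nonneg)
  have \<omega>0: "0 \<le> \<omega>"
    unfolding \<omega>_def
    by (rule order_trans[OF _ third_difference_le_modulus[OF f, of 0]]) auto
  consider "1 / 27 \<le> lam" | "0 < lam" "lam < 1 / 27" | "lam = 0" using lam0 by linarith
  then have "R \<le> 20000 * (1 + L) * (N * lam + \<omega>)"
  proof cases
    case 1
    have "Lp_norm 1 (\<lambda>x. f x + (-1) * T f x) \<le> Lp_norm 1 f + Lp_norm 1 (\<lambda>x. (-1) * T f x)"
      by (intro Lp_norm_1_add scale_in T_in' f)
    then have "R \<le> N + L * N"
      using op_norm_bound(1)[OF f] unfolding Lp_norm_1_scale by (simp add: R_def N_def)
    also have "\<dots> = (1 + L) * N" by (simp add: algebra_simps)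
    also have "\<dots> \<le> (1 + L) * (N * (20000 * lam))"
      using 1 L0 N0 by (intro mult_left_mono) (auto simp: mult_le_cancel_left1)
    also have "\<dots> = 20000 * (1 + L) * (N * lam)" by simp
    also have "\<dots> \<le> 20000 * (1 + L) * (N * lam + \<omega>)"
      using L0 \<omega>0 by (intro mult_left_mono) auto
    finally show ?thesis .
  next
    case 2
    have bound: "R \<le> 20000 * (1 + L) * (N * lam + \<omega>) + 40000 * (1 + L) * \<eta>" if \<eta>: "0 < \<eta>" for \<eta>
    proof -
      have "R \<le> (1 + L) * (\<eta> + 6 * (\<omega> + 8 * \<eta>))
          + 10 * (1477 * (N + \<eta> + 6 * (\<omega> + 8 * \<eta>)) * lam + 93 * (\<omega> + 8 * \<eta>))"
        using error_estimate_approx[OF f \<eta>] 2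
        unfolding lam_def[symmetric] N_def[symmetric] R_def[symmetric] \<omega>_def[symmetric] by simp
      \<comment> \<open>The coefficient 14770 = 10 * 1477 of \<open>N * lam\<close> is what the
        constant 20000 has to exceed; \<open>lam < 1 / 27\<close> brings the other coefficients
        below their bounds.\<close>
      also have "\<dots> = (6 * (1 + L) + 88620 * lam + 930) * \<omega> + 14770 * (N * lam)
          + (49 * (1 + L) + 723730 * lam + 7440) * \<eta>"
        by (simp add: algebra_simps)
      also have "\<dots> \<le> (20000 * (1 + L)) * \<omega> + (20000 * (1 + L)) * (N * lam) + (40000 * (1 + L)) * \<eta>"
        using 2 L0 N0 \<omega>0 \<eta> by (intro add_mono mult_right_mono) auto
      finally show ?thesis by (simp add: algebra_simps)
    qed
    show ?thesis
    \<comment> \<open>The approximation error is arbitrary and no longer tied to \<epsilon>, so its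
      contribution can be made as small as desired.\<close>
    proof (rule field_le_epsilon)
      fix \<delta> :: real assume \<delta>: "0 < \<delta>"
      have "40000 * (1 + L) * (\<delta> / (40000 * (1 + L))) = \<delta>" using L0 by simp
      then show "R \<le> 20000 * (1 + L) * (N * lam + \<omega>) + \<delta>"
        using bound[of "\<delta> / (40000 * (1 + L))"] \<delta> L0 by simp
    qed
  next
    case 3
    then have "R \<le> 0" unfolding R_def lam_def by (rule error_zero[OF f])
    also have "\<dots> \<le> 20000 * (1 + L) * (N * lam + \<omega>)"
      using L0 N0 lam0 \<omega>0 by auto
    finally show ?thesis .
  qed
  then show ?thesis
    by (simp add: R_def N_def lam_def \<omega>_def)
qed

end

section \<open>Both estimates, with constants linear in the operator norm\<close>

theorem theorem3:
  shows "(\<exists>C :: real \<Rightarrow> real. \<forall>T.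
           T \<in> C_01 \<rightarrow> C_01 \<and> sublinear_on C_01 le_C T \<and> monotone_on C_01 le_C le_C T \<and>
           strongly_translatable_on C_01 le_C T \<longrightarrow>
           (\<forall>f\<in>C_01.
              Lp_norm \<infinity> (\<lambda>x. f x - T f x) \<le>
                C (op_norm \<infinity> C_01 T) *
                  (Lp_norm \<infinity> f * korovkin_lambda \<infinity> T +
                   modulus_of_smoothness 2 \<infinity> f (korovkin_lambda \<infinity> T powr (1 / 2))))) \<and>
         (\<exists>C :: real \<Rightarrow> real. \<forall>T.
           T \<in> L1_01 \<rightarrow> L1_01 \<and> sublinear_on L1_01 le_L1 T \<and> monotone_on L1_01 le_L1 le_L1 T \<and>
           strongly_translatable_on L1_01 le_L1 T \<longrightarrow>
           (\<forall>f\<in>L1_01.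
              Lp_norm 1 (\<lambda>x. f x - T f x) \<le>
                C (op_norm 1 L1_01 T) *
                  (Lp_norm 1 f * korovkin_lambda 1 T +
                   modulus_of_smoothness 3 1 f (korovkin_lambda 1 T powr (1 / 3)))))"
proof (intro conjI)
  show "\<exists>C :: real \<Rightarrow> real. \<forall>T.
           T \<in> C_01 \<rightarrow> C_01 \<and> sublinear_on C_01 le_C T \<and> monotone_on C_01 le_C le_C T \<and>
           strongly_translatable_on C_01 le_C T \<longrightarrow>
           (\<forall>f\<in>C_01.
              Lp_norm \<infinity> (\<lambda>x. f x - T f x) \<le>
                C (op_norm \<infinity> C_01 T) *
                  (Lp_norm \<infinity> f * korovkin_lambda \<infinity> T +
                   modulus_of_smoothness 2 \<infinity> f (korovkin_lambda \<infinity> T powr (1 / 2))))"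
    using korovkin_operator_C.error_estimate
    by (intro exI[of _ "\<lambda>L. 100 * (1 + L)"]) (simp add: korovkin_operator_C_def)
  show "\<exists>C :: real \<Rightarrow> real. \<forall>T.
           T \<in> L1_01 \<rightarrow> L1_01 \<and> sublinear_on L1_01 le_L1 T \<and> monotone_on L1_01 le_L1 le_L1 T \<and>
           strongly_translatable_on L1_01 le_L1 T \<longrightarrow>
           (\<forall>f\<in>L1_01.
              Lp_norm 1 (\<lambda>x. f x - T f x) \<le>
                C (op_norm 1 L1_01 T) *
                  (Lp_norm 1 f * korovkin_lambda 1 T +
                   modulus_of_smoothness 3 1 f (korovkin_lambda 1 T powr (1 / 3))))"
    using korovkin_operator_L1.error_estimate
    by (intro exI[of _ "\<lambda>L. 20000 * (1 + L)"]) (simp add: korovkin_operator_L1_def)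
qed

end
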